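(* Let $m\in\mathbb{N}$, let $\Delta=\{F_1,\dots,F_q\}$ be a collection of facets on the vertex set $[m]$, let $T\subset[m]$ be a non-empty subset, and fix the numbers of states $\mathbf{c}\in\mathbb{N}^{m-\#T}$ of the parameters in $[m]\setminus T$. Assume that (1) $F_i\cap F_j=\emptyset$ for any distinct $F_i,F_j\in\Delta$; (2) $\#(F\cap T)\le 1$ for any $F\in\Delta$. Then the equivariant Hilbert series $$\mathrm{equivH}_{\mathscr{I}_{\Delta,\mathbf{r}_{[m]\setminus T}}}(s_1,\dots,s_{\#T},t)=\sum_{\mathbf{n}\in\mathbb{N}^{\#T}}H_{R_{(\mathbf{c},\mathbf{n})}/I_{\mathcal{M}(\Delta,\mathbf{n})}}(t)\, s_1^{n_1}\cdots s_{\#T}^{n_{\#T}}$$ is a rational function in $s_1,\dots,s_{\#T},t$ with rational coefficients.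
   Context: $\mathbb{N}$ denotes the positive integers, $[n]=\{1,\dots,n\}$, and $\mathbb{K}$ is a field. A collection of facets on $[m]$ is a collection $\Delta=\{F_1,\dots,F_q\}$ of non-empty subsets of $[m]$ with $\bigcup_j F_j=[m]$ and with no $F_j$ contained in some $F_i$, $i\ne j$. For a vector of states $\mathbf{r}=(r_1,\dots,r_m)\in\mathbb{N}^m$ and $F=\{i_1<\dots<i_s\}\subset[m]$, put $\mathbf{r}_F=(r_{i_1},\dots,r_{i_s})$ and $[\mathbf{r}_F]=[r_{i_1}]\times\cdots\times[r_{i_s}]$; in particular $[\mathbf{r}]=[r_1]\times\cdots\times[r_m]$. For $\mathbf{i}\in[\mathbf{r}]$, $\mathbf{i}_F$ is the restriction of $\mathbf{i}$ to the positions in $F$. The hierarchical model $\mathcal{M}=\mathcal{M}(\Delta,\mathbf{r})$ determines the $\mathbb{K}$-algebra homomorphism $$\Phi_{\mathcal{M}}\colon R_{\mathbf{r}}=\mathbb{K}[x_{\mathbf{i}}\mid \mathbf{i}\in[\mathbf{r}]]\to \mathbb{K}[y_{j,\mathbf{k}}\mid j\in[q],\ \mathbf{k}\in[\mathbf{r}_{F_j}]],\qquad x_{\mathbf{i}}\mapsto\prod_{j=1}^q y_{j,\mathbf{i}_{F_j}},$$ and its toric ideal is $I_{\mathcal{M}}=\ker\Phi_{\mathcal{M}}\subset R_{\mathbf{r}}$. For $\mathbf{n}\in\mathbb{N}^{\#T}$, $(\mathbf{c},\mathbf{n})\in\mathbb{N}^m$ denotes the vector of states whose entries in positions $[m]\setminus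 T$ are given by $\mathbf{c}$ and whose entries in positions $T$ are given by $\mathbf{n}$ (in increasing order of positions). Write $\mathcal{M}(\Delta,\mathbf{n})$ for $\mathcal{M}(\Delta,(\mathbf{c},\mathbf{n}))$. The family $(I_{\mathcal{M}(\Delta,\mathbf{n})})_{\mathbf{n}\in\mathbb{N}^{\#T}}$ is denoted $\mathscr{I}_{\Delta,\mathbf{r}_{[m]\setminus T}}$. For a homogeneous ideal $I$ in a polynomial ring $R$ whose variables all have degree one, $H_{R/I}(t)=\sum_{d\ge0}\dim_{\mathbb{K}}[R/I]_d\,t^d$ is the Hilbert series of $R/I$. *)

theory Defs
  imports
    "HOL-Algebra.QuotRing"
    "HOL-Algebra.Embedded_Algebras"
    "HOL-Computational_Algebra.Formal_Power_Series"
    "HOL-Library.Poly_Mapping"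
begin

section \<open>Polynomial rings, homogeneous components and Hilbert series\<close>

text \<open>A monomial is its exponent vector, a polynomial the finitely supported family of its
  coefficients.\<close>

type_synonym ('v, 'k) mpoly = "('v \<Rightarrow>\<^sub>0 nat) \<Rightarrow>\<^sub>0 'k"

definition mpolys :: "'v set \<Rightarrow> ('v, 'k::zero) mpoly set" where
  "mpolys V = {p. \<forall>u \<in> Poly_Mapping.keys p. Poly_Mapping.keys u \<subseteq> V}"

definition mpoly_ring :: "'v set \<Rightarrow> ('v, 'k::comm_ring_1) mpoly ring" where
  "mpoly_ring V = \<lparr>carrier = mpolys V, monoid.mult = (*), one = 1, zero = 0, add = (+)\<rparr>"

definition mconst :: "'k::zero \<Rightarrow> ('v, 'k) mpoly" where
  "mconst a = Poly_Mapping.single 0 a"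

definition mvar :: "'v \<Rightarrow> ('v, 'k::zero_neq_one) mpoly" where
  "mvar v = Poly_Mapping.single (Poly_Mapping.single v 1) 1"

text \<open>The algebra homomorphism with \<open>v \<mapsto> f v\<close> on the variables.\<close>

definition msubst :: "('v \<Rightarrow> ('w, 'k::comm_ring_1) mpoly) \<Rightarrow> ('v, 'k) mpoly \<Rightarrow> ('w, 'k) mpoly" where
  "msubst f p = (\<Sum>u \<in> Poly_Mapping.keys p.
     mconst (Poly_Mapping.lookup p u) *
     (\<Prod>v \<in> Poly_Mapping.keys u. f v ^ Poly_Mapping.lookup u v))"

definition mono_degree :: "('v \<Rightarrow>\<^sub>0 nat) \<Rightarrow> nat" where
  "mono_degree u = (\<Sum>v \<in> Poly_Mapping.keys u. Poly_Mapping.lookup u v)"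

definition homogeneous_part :: "'v set \<Rightarrow> nat \<Rightarrow> ('v, 'k::zero) mpoly set" where
  "homogeneous_part V d = {p \<in> mpolys V. \<forall>u \<in> Poly_Mapping.keys p. mono_degree u = d}"

text \<open>Inside the residue class ring \<open>R/I\<close>, the component \<open>[R/I]\<^sub>d\<close> consists of the classes of the
  forms of degree \<open>d\<close>, and the base field is embedded as the classes of the constants.\<close>

definition quot_component ::
    "'v set \<Rightarrow> ('v, 'k::field) mpoly set \<Rightarrow> nat \<Rightarrow> ('v, 'k) mpoly set set" where
  "quot_component V I d = (\<lambda>p. I +>\<^bsub>mpoly_ring V\<^esub> p) ` homogeneous_part V d"

definition quot_field :: "'v set \<Rightarrow> ('v, 'k::field) mpoly set \<Rightarrow> ('v, 'k) mpoly set set" where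
  "quot_field V I = range (\<lambda>a. I +>\<^bsub>mpoly_ring V\<^esub> mconst a)"

definition hilbert_series :: "'v set \<Rightarrow> ('v, 'k::field) mpoly set \<Rightarrow> rat fps" where
  "hilbert_series V I =
     Abs_fps (\<lambda>d. of_nat (ring.dim (mpoly_ring V Quot I) (quot_field V I) (quot_component V I d)))"

section \<open>Hierarchical models\<close>

text \<open>The facets are \<open>F 1, \<dots>, F q\<close>. Vectors indexed by \<open>{1..s}\<close> are functions on \<open>nat\<close> of which
  only the values on \<open>{1..s}\<close> matter.\<close>

definition facet_collection :: "nat \<Rightarrow> nat \<Rightarrow> (nat \<Rightarrow> nat set) \<Rightarrow> bool" where
  "facet_collection m q F \<longleftrightarrow>
     (\<forall>j \<in> {1..q}. F j \<noteq> {} \<and> F j \<subseteq> {1..m}) \<and>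
     (\<Union>j \<in> {1..q}. F j) = {1..m} \<and>
     (\<forall>i \<in> {1..q}. \<forall>j \<in> {1..q}. i \<noteq> j \<longrightarrow> \<not> F j \<subseteq> F i)"

text \<open>The product \<open>[r\<^sub>A]\<close>. Its elements keep the positions in \<open>A\<close> as their index set instead of
  being renumbered, so \<open>i\<^sub>A\<close> is \<open>restrict i A\<close>.\<close>

definition state_set :: "(nat \<Rightarrow> nat) \<Rightarrow> nat set \<Rightarrow> (nat \<Rightarrow> nat) set" where
  "state_set r A = (\<Pi>\<^sub>E v \<in> A. {1..r v})"

definition model_vars :: "nat \<Rightarrow> (nat \<Rightarrow> nat) \<Rightarrow> (nat \<Rightarrow> nat) set" where
  "model_vars m r = state_set r {1..m}"

definition param_vars :: "nat \<Rightarrow> (nat \<Rightarrow> nat set) \<Rightarrow> (nat \<Rightarrow> nat) \<Rightarrow> (nat \<times> (nat \<Rightarrow> nat)) set" where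
  "param_vars q F r = (SIGMA j:{1..q}. state_set r (F j))"

definition model_map :: "nat \<Rightarrow> (nat \<Rightarrow> nat set) \<Rightarrow>
    (nat \<Rightarrow> nat, 'k::field) mpoly \<Rightarrow> (nat \<times> (nat \<Rightarrow> nat), 'k) mpoly" where
  "model_map q F = msubst (\<lambda>i. \<Prod>j \<in> {1..q}. mvar (j, restrict i (F j)))"

definition toric_ideal :: "nat \<Rightarrow> nat \<Rightarrow> (nat \<Rightarrow> nat set) \<Rightarrow> (nat \<Rightarrow> nat) \<Rightarrow>
    (nat \<Rightarrow> nat, 'k::field) mpoly set" where
  "toric_ideal m q F r =
     a_kernel (mpoly_ring (model_vars m r)) (mpoly_ring (param_vars q F r)) (model_map q F)"

text \<open>The vector \<open>(c, n)\<close>: \<open>card {u \<in> A. u \<le> v}\<close> is the rank of \<open>v\<close> in \<open>A\<close>.\<close>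

definition merge_states ::
    "nat \<Rightarrow> nat set \<Rightarrow> (nat \<Rightarrow> nat) \<Rightarrow> (nat \<Rightarrow> nat) \<Rightarrow> nat \<Rightarrow> nat" where
  "merge_states m T c n v =
     (if v \<in> T then n (card {u \<in> T. u \<le> v}) else c (card {u \<in> {1..m} - T. u \<le> v}))"

section \<open>Multivariate power series and the equivariant Hilbert series\<close>

type_synonym ('v, 'a) mseries = "('v \<Rightarrow>\<^sub>0 nat) \<Rightarrow> 'a"

lemma finite_mono_splittings:
  fixes e :: "'v \<Rightarrow>\<^sub>0 nat"
  shows "finite {(a, b). a + b = e}"
proof -
  let ?f = "\<lambda>g. Abs_poly_mapping (\<lambda>v. if v \<in> Poly_Mapping.keys e then g v else 0) :: 'v \<Rightarrow>\<^sub>0 nat"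
  let ?G = "\<Pi>\<^sub>E v \<in> Poly_Mapping.keys e. {..Poly_Mapping.lookup e v}"
  have "a \<in> ?f ` ?G" if "a + b = e" for a b
  proof
    have le: "Poly_Mapping.lookup a v \<le> Poly_Mapping.lookup e v" for v
      using that by (auto simp: lookup_add)
    then show "restrict (Poly_Mapping.lookup a) (Poly_Mapping.keys e) \<in> ?G" by auto
    have "Poly_Mapping.lookup a v = 0" if "v \<notin> Poly_Mapping.keys e" for v
      using le[of v] that by (simp add: in_keys_iff)
    then have "(\<lambda>v. if v \<in> Poly_Mapping.keys e
        then restrict (Poly_Mapping.lookup a) (Poly_Mapping.keys e) v else 0) = Poly_Mapping.lookup a"
      by (auto simp: fun_eq_iff)
    then show "a = ?f (restrict (Poly_Mapping.lookup a) (Poly_Mapping.keys e))"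
      by (simp add: lookup_inverse)
  qed
  moreover have "b \<in> ?f ` ?G" if "a + b = e" for a b
    using calculation[of b a] that by (simp add: add.commute)
  ultimately have "{(a, b). a + b = e} \<subseteq> (?f ` ?G) \<times> (?f ` ?G)" by auto
  moreover have "finite ?G" by (intro finite_PiE) auto
  ultimately show ?thesis by (meson finite_SigmaI finite_imageI finite_subset)
qed

definition mseries_mult ::
    "('v, 'a::comm_semiring_0) mseries \<Rightarrow> ('v, 'a) mseries \<Rightarrow> ('v, 'a) mseries" where
  "mseries_mult f g e = (\<Sum>(a, b) \<in> {(a, b). a + b = e}. f a * g b)"

text \<open>\<open>h\<close> is a rational function \<open>P/Q\<close> in the variables \<open>V\<close>, i.e.\ \<open>Q h = P\<close> with \<open>Q \<noteq> 0\<close> holds in the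
  ring (a domain) of power series.\<close>

definition rational_mseries :: "'v set \<Rightarrow> ('v, rat) mseries \<Rightarrow> bool" where
  "rational_mseries V h \<longleftrightarrow>
     (\<exists>P \<in> mpolys V. \<exists>Q \<in> mpolys V. Q \<noteq> 0 \<and>
       mseries_mult (Poly_Mapping.lookup Q) h = Poly_Mapping.lookup P)"

text \<open>Variable \<open>0\<close> is \<open>t\<close> and variable \<open>k \<in> {1..card T}\<close> is \<open>s\<^sub>k\<close>. The outer sum runs over vectors \<open>n\<close> of
  positive integers, so monomials not divisible by every \<open>s\<^sub>k\<close> have coefficient \<open>0\<close>. The base
  field is passed as a type.\<close>

definition equiv_hilbert_series :: "'k::field itself \<Rightarrow> nat \<Rightarrow> nat \<Rightarrow> (nat \<Rightarrow> nat set) \<Rightarrow>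
    nat set \<Rightarrow> (nat \<Rightarrow> nat) \<Rightarrow> (nat, rat) mseries" where
  "equiv_hilbert_series _ m q F T c e =
     (if Poly_Mapping.keys e \<subseteq> {0..card T} \<and> (\<forall>k \<in> {1..card T}. Poly_Mapping.lookup e k \<ge> 1)
      then (let r = merge_states m T c (Poly_Mapping.lookup e)
            in fps_nth
                 (hilbert_series (model_vars m r)
                   (toric_ideal m q F r :: (nat \<Rightarrow> nat, 'k) mpoly set))
                 (Poly_Mapping.lookup e 0))
      else 0)"

end

theory Submission
  imports Defs "HOL-Library.Nat_Bijection"
begin

text \<open>
  Write \<open>N\<^sub>j\<close> for the product of the numbers of states over the facet \<open>F j\<close>. As the facets partition the
  vertices, an index of a variable \<open>x\<^sub>i\<close> is an arbitrary choice of one index \<open>i\<^sub>F\<close> for every facet.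
  Therefore the monomials of degree \<open>d\<close> are mapped onto \<^emph>\<open>all\<close> monomials that have degree \<open>d\<close> in each of
  the groups of variables \<open>y\<^sub>j\<close>: the algebra \<open>R/I\<close> is the Segre product of polynomial rings in
  \<open>N\<^sub>1, \<dots>, N\<^sub>q\<close> variables. Distinct monomials are linearly independent, so \<open>[R/I]\<^sub>d\<close> has dimension
  \<open>\<Prod>\<^sub>j multichoose N\<^sub>j d\<close> with \<open>multichoose N d = (N + d - 1) choose d\<close>
  (\<open>dim_quotient_by_monomial_kernel\<close>, \<open>hilbert_function_disjoint_facets\<close>).

  Every vertex of \<open>T\<close> lies in exactly one facet and no facet contains two of them. Hence the varying
  numbers of states enter separately: \<open>N\<^sub>j = b\<^sub>j n\<^sub>k\<close> if \<open>F j\<close> contains the \<open>k\<close>-th vertex of \<open>T\<close>, and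
  \<open>N\<^sub>j = b\<^sub>j\<close> is constant if \<open>F j\<close> avoids \<open>T\<close>. The equivariant Hilbert series is the sum over \<open>d\<close> of
  \<open>t\<^sup>d\<close> times a product of series \<open>\<Sum>\<^sub>n multichoose (b n) d s\<^sub>k\<^sup>n\<close> in separate variables, times constants
  \<open>multichoose b\<^sub>j d\<close>.

  What is left is a Hadamard product in \<open>t\<close> of rational series with coefficients that depend on the
  \<open>s\<^sub>k\<close>. Rationality is transported through this product by linear recurrences. By Pascal's rule, each
  factor, as a sequence in \<open>d\<close>, is a component of a vector \<open>v\<close> with \<open>v (d + 1) = M v d\<close> where \<open>v 0\<close> and the
  matrix \<open>M\<close> are rational in \<open>s\<^sub>k\<close> (\<open>recurrent_univariate_multichoose\<close>). Tensor products of vectors of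
  this kind are again of this kind (\<open>recurrent_mult\<close>), and \<open>w = \<Sum>\<^sub>d v d t\<^sup>d\<close> solves the linear system
  \<open>w = v 0 + t M w\<close>, so that it is rational by Gaussian elimination (\<open>linear_system_rat_series\<close>,
  \<open>power_sum_rat_series\<close>).
\<close>

section \<open>Polynomials in a set of variables\<close>

lemma mpolys_zero [simp]: "0 \<in> mpolys V"
  by (simp add: mpolys_def)

lemma mpolys_add: "p \<in> mpolys V \<Longrightarrow> q \<in> mpolys V \<Longrightarrow> p + q \<in> mpolys V"
  for p :: "('v, 'k::monoid_add) mpoly"
  using keys_add[of p q] by (auto simp: mpolys_def)

lemma mpolys_uminus: "p \<in> mpolys V \<Longrightarrow> - p \<in> mpolys V"
  for p :: "('v, 'k::ab_group_add) mpoly"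
  by (auto simp: mpolys_def in_keys_iff)

lemma mpolys_diff: "p \<in> mpolys V \<Longrightarrow> q \<in> mpolys V \<Longrightarrow> p - q \<in> mpolys V"
  for p :: "('v, 'k::ab_group_add) mpoly"
  using mpolys_add[OF _ mpolys_uminus, of p V q] by simp

lemma keys_add_nat:
  "Poly_Mapping.keys (a + b) = Poly_Mapping.keys a \<union> Poly_Mapping.keys b" for a b :: "'v \<Rightarrow>\<^sub>0 nat"
  by (auto simp: in_keys_iff lookup_add)

lemma mpolys_mult:
  fixes p :: "('v, 'k::comm_ring_1) mpoly"
  assumes "p \<in> mpolys V" "q \<in> mpolys V"
  shows "p * q \<in> mpolys V"
proof -
  have "Poly_Mapping.keys w \<subseteq> V" if w: "w \<in> Poly_Mapping.keys (p * q)" for w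
  proof -
    obtain a b where "w = a + b" "a \<in> Poly_Mapping.keys p" "b \<in> Poly_Mapping.keys q"
      using w keys_mult[of p q] by blast
    then show ?thesis
      using assms by (auto simp: mpolys_def keys_add_nat)
  qed
  then show ?thesis by (auto simp: mpolys_def)
qed

lemma mpolys_mconst [simp]: "mconst a \<in> mpolys V"
  by (simp add: mpolys_def mconst_def)

lemma mconst_one: "mconst 1 = 1"
  by (simp add: mconst_def)

lemma mpolys_one [simp]: "(1 :: ('v, 'k::comm_ring_1) mpoly) \<in> mpolys V"
  by (metis mpolys_mconst mconst_one)

lemma mpolys_mvar: "v \<in> V \<Longrightarrow> mvar v \<in> mpolys V"
  by (auto simp: mpolys_def mvar_def)

section \<open>The ring of multivariate power series\<close>

typedef 'v series = "UNIV :: (('v \<Rightarrow>\<^sub>0 nat) \<Rightarrow> rat) set"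
  morphisms coef Series by auto

declare Series_inverse [OF UNIV_I, simp] coef_inverse [simp]

lemma series_eqI: "(\<And>e. coef f e = coef g e) \<Longrightarrow> f = g"
  by (metis coef_inject ext)

abbreviation splittings :: "('v \<Rightarrow>\<^sub>0 nat) \<Rightarrow> (('v \<Rightarrow>\<^sub>0 nat) \<times> ('v \<Rightarrow>\<^sub>0 nat)) set" where
  "splittings e \<equiv> {(a, b). a + b = e}"

lemma exponent_add_eq_0: "a + b = 0 \<longleftrightarrow> a = 0 \<and> b = 0" for a b :: "'v \<Rightarrow>\<^sub>0 nat"
proof
  assume "a + b = 0"
  then have "Poly_Mapping.lookup a v + Poly_Mapping.lookup b v = 0" for v
    by (metis lookup_add lookup_zero)
  then show "a = 0 \<and> b = 0" by (auto intro!: poly_mapping_eqI)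
qed simp

lemma splittings_0: "splittings 0 = {(0, 0)}"
  by (auto simp: exponent_add_eq_0)

instantiation series :: (type) comm_ring_1
begin

definition "0 = Series (\<lambda>_. 0)"
definition "1 = Series (\<lambda>e. if e = 0 then 1 else 0)"
definition "f + g = Series (\<lambda>e. coef f e + coef g e)"
definition "f - g = Series (\<lambda>e. coef f e - coef g e)"
definition "- f = Series (\<lambda>e. - coef f e)"
definition "f * g = Series (mseries_mult (coef f) (coef g))"

instance
proof
  fix f g h :: "'a series"
  show "f * g = g * f"
  proof (rule series_eqI)
    fix e
    show "coef (f * g) e = coef (g * f) e"
      unfolding times_series_def mseries_mult_def Series_inverse[OF UNIV_I]
      by (rule sum.reindex_bij_witness[of _ "\<lambda>(a, b). (b, a)" "\<lambda>(a, b). (b, a)"])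
        (auto simp: add.commute)
  qed
  show "(f * g) * h = f * (g * h)"
  proof (rule series_eqI)
    fix e
    have "coef ((f * g) * h) e = (\<Sum>p\<in>splittings e. \<Sum>q\<in>splittings (fst p).
        coef f (fst q) * coef g (snd q) * coef h (snd p))"
      by (simp add: times_series_def mseries_mult_def case_prod_unfold sum_distrib_right)
    also have "\<dots> = (\<Sum>(p, q)\<in>(SIGMA p:splittings e. splittings (fst p)).
        coef f (fst q) * coef g (snd q) * coef h (snd p))"
      by (rule sum.Sigma) (auto simp: finite_mono_splittings)
    also have "\<dots> = (\<Sum>(p, q)\<in>(SIGMA p:splittings e. splittings (snd p)).
        coef f (fst p) * (coef g (fst q) * coef h (snd q)))"
      by (rule sum.reindex_bij_witness[of _ "\<lambda>((a, b), (x, y)). ((a + x, y), (a, x))"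
            "\<lambda>((a, b), (x, y)). ((x, y + b), (y, b))"]) (auto simp: add.assoc)
    also have "\<dots> = (\<Sum>p\<in>splittings e. \<Sum>q\<in>splittings (snd p).
        coef f (fst p) * (coef g (fst q) * coef h (snd q)))"
      by (rule sum.Sigma[symmetric]) (auto simp: finite_mono_splittings)
    also have "\<dots> = coef (f * (g * h)) e"
      by (simp add: times_series_def mseries_mult_def case_prod_unfold sum_distrib_left)
    finally show "coef ((f * g) * h) e = coef (f * (g * h)) e" .
  qed
  show "1 * f = f"
  proof (rule series_eqI)
    fix e
    have "coef (1 * f) e = (\<Sum>(a, b)\<in>splittings e. (if a = 0 then 1 else 0) * coef f b)"
      by (simp add: times_series_def one_series_def mseries_mult_def)
    also have "\<dots> = (\<Sum>(a, b)\<in>{(0 :: 'a \<Rightarrow>\<^sub>0 nat, e)}. (if a = 0 then 1 else 0) * coef f b)"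
      by (rule sum.mono_neutral_cong_right) (auto simp: finite_mono_splittings split: if_splits)
    finally show "coef (1 * f) e = coef f e" by simp
  qed
  show "(f + g) * h = f * h + g * h"
    by (rule series_eqI)
      (simp add: times_series_def plus_series_def mseries_mult_def case_prod_unfold
        distrib_right sum.distrib)
  show "(0 :: 'a series) \<noteq> 1"
    by (metis (mono_tags) Series_inverse UNIV_I one_series_def zero_neq_one zero_series_def)
qed (auto intro!: series_eqI simp: plus_series_def zero_series_def uminus_series_def minus_series_def)

end

lemma coef_zero [simp]: "coef 0 e = 0"
  and coef_add [simp]: "coef (f + g) e = coef f e + coef g e"
  and coef_diff [simp]: "coef (f - g) e = coef f e - coef g e"
  by (simp_all add: zero_series_def plus_series_def minus_series_def)

lemma coef_one: "coef 1 e = (if e = 0 then 1 else 0)"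
  by (simp add: one_series_def)

lemma coef_mult: "coef (f * g) e = (\<Sum>(a, b)\<in>splittings e. coef f a * coef g b)"
  by (simp add: times_series_def mseries_mult_def)

lemma coef_sum [simp]: "coef (\<Sum>i\<in>I. f i) e = (\<Sum>i\<in>I. coef (f i) e)"
  by (induction I rule: infinite_finite_induct) auto

definition series_of_poly :: "('v, rat) mpoly \<Rightarrow> 'v series" where
  "series_of_poly p = Series (Poly_Mapping.lookup p)"

lemma coef_series_of_poly [simp]: "coef (series_of_poly p) = Poly_Mapping.lookup p"
  by (simp add: series_of_poly_def)

lemma lookup_mult_eq_mseries_mult:
  "Poly_Mapping.lookup (p * q) = mseries_mult (Poly_Mapping.lookup p) (Poly_Mapping.lookup q)"
  for p q :: "('v, 'k::comm_semiring_0) mpoly"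
proof
  fix e
  let ?h = "\<lambda>(a, b). Poly_Mapping.lookup p a * Poly_Mapping.lookup q b when e = a + b"
  have "Poly_Mapping.lookup (p * q) e = (\<Sum>(a, b).
      Poly_Mapping.lookup p a * Poly_Mapping.lookup q b when e = a + b)"
    by (simp add: times_poly_mapping.rep_eq prod_fun_unfold_prod)
  also have "\<dots> = (\<Sum>x\<in>splittings e. ?h x)"
    by (rule Sum_any.expand_superset) (auto simp: finite_mono_splittings when_def split: if_splits)
  also have "\<dots> = mseries_mult (Poly_Mapping.lookup p) (Poly_Mapping.lookup q) e"
    unfolding mseries_mult_def by (rule sum.cong) (auto simp: when_def)
  finally show "Poly_Mapping.lookup (p * q) e
    = mseries_mult (Poly_Mapping.lookup p) (Poly_Mapping.lookup q) e" .
qed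

lemma series_of_poly_hom:
  "series_of_poly (p + q) = series_of_poly p + series_of_poly q"
  "series_of_poly (p - q) = series_of_poly p - series_of_poly q"
  "series_of_poly (p * q) = series_of_poly p * series_of_poly q"
  "series_of_poly 0 = 0" "series_of_poly 1 = 1"
  by (auto intro!: series_eqI simp: lookup_add lookup_minus lookup_mult_eq_mseries_mult
      times_series_def coef_one lookup_one when_def)

lemma lookup_mult_0:
  "Poly_Mapping.lookup (p * q) 0 = Poly_Mapping.lookup p 0 * Poly_Mapping.lookup q 0"
  for p q :: "('v, 'k::comm_semiring_0) mpoly"
  by (simp add: lookup_mult_eq_mseries_mult mseries_mult_def splittings_0)

section \<open>Rational power series\<close>

text \<open>Only denominators with constant coefficient 1 are admitted. They are closed under products and
  under \<open>Q - t P\<close>, they are never 0, and all denominators below are of this form; so rational series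
  can be handled inside the ring of power series, without a field of fractions.\<close>
definition rat_series :: "'v set \<Rightarrow> 'v series set" where
  "rat_series V = {h. \<exists>P\<in>mpolys V. \<exists>Q\<in>mpolys V.
     Poly_Mapping.lookup Q 0 = 1 \<and> series_of_poly Q * h = series_of_poly P}"

lemma rat_seriesI:
  "P \<in> mpolys V \<Longrightarrow> Q \<in> mpolys V \<Longrightarrow> Poly_Mapping.lookup Q 0 = 1 \<Longrightarrow>
    series_of_poly Q * h = series_of_poly P \<Longrightarrow> h \<in> rat_series V"
  by (auto simp: rat_series_def)

lemma rat_seriesE:
  assumes "h \<in> rat_series V"
  obtains P Q where "P \<in> mpolys V" "Q \<in> mpolys V" "Poly_Mapping.lookup Q 0 = 1"
    "series_of_poly Q * h = series_of_poly P"
  using assms by (auto simp: rat_series_def)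

lemma rational_mseries_if_rat_series: "h \<in> rat_series V \<Longrightarrow> rational_mseries V (coef h)"
proof (elim rat_seriesE)
  fix P Q assume *: "P \<in> mpolys V" "Q \<in> mpolys V" "Poly_Mapping.lookup Q 0 = 1"
    "series_of_poly Q * h = series_of_poly P"
  then have "mseries_mult (Poly_Mapping.lookup Q) (coef h) = Poly_Mapping.lookup P"
    by (metis (no_types) Series_inverse UNIV_I coef_series_of_poly times_series_def)
  moreover have "Q \<noteq> 0" using * by auto
  ultimately show ?thesis using * by (auto simp: rational_mseries_def)
qed

lemma rat_series_poly: "P \<in> mpolys V \<Longrightarrow> series_of_poly P \<in> rat_series V"
  by (rule rat_seriesI[of P V 1]) (auto simp: series_of_poly_hom)

lemma rat_series_0 [simp]: "0 \<in> rat_series V"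
  and rat_series_1 [simp]: "1 \<in> rat_series V"
  using rat_series_poly[of 0 V] rat_series_poly[of 1 V] by (simp_all add: series_of_poly_hom)

lemma rat_series_add:
  assumes "f \<in> rat_series V" "g \<in> rat_series V"
  shows "f + g \<in> rat_series V"
proof -
  obtain P Q P' Q' where
    *: "P \<in> mpolys V" "Q \<in> mpolys V" "Poly_Mapping.lookup Q 0 = 1"
      "P' \<in> mpolys V" "Q' \<in> mpolys V" "Poly_Mapping.lookup Q' 0 = 1"
    and e: "series_of_poly Q * f = series_of_poly P" "series_of_poly Q' * g = series_of_poly P'"
    using assms by (elim rat_seriesE)
  have "series_of_poly (Q * Q') * (f + g)
      = series_of_poly Q' * (series_of_poly Q * f) + series_of_poly Q * (series_of_poly Q' * g)"
    by (simp add: series_of_poly_hom algebra_simps)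
  also have "\<dots> = series_of_poly (Q' * P + Q * P')"
    by (simp add: e series_of_poly_hom)
  finally show ?thesis
    by (intro rat_seriesI) (use * in \<open>auto intro!: mpolys_add mpolys_mult simp: lookup_mult_0\<close>)
qed

lemma rat_series_mult:
  assumes "f \<in> rat_series V" "g \<in> rat_series V"
  shows "f * g \<in> rat_series V"
proof -
  obtain P Q P' Q' where
    *: "P \<in> mpolys V" "Q \<in> mpolys V" "Poly_Mapping.lookup Q 0 = 1"
      "P' \<in> mpolys V" "Q' \<in> mpolys V" "Poly_Mapping.lookup Q' 0 = 1"
    and e: "series_of_poly Q * f = series_of_poly P" "series_of_poly Q' * g = series_of_poly P'"
    using assms by (elim rat_seriesE)
  have "series_of_poly (Q * Q') * (f * g)
      = (series_of_poly Q * f) * (series_of_poly Q' * g)"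
    by (simp add: series_of_poly_hom algebra_simps)
  also have "\<dots> = series_of_poly (P * P')"
    by (simp add: e series_of_poly_hom)
  finally show ?thesis
    by (intro rat_seriesI) (use * in \<open>auto intro!: mpolys_mult simp: lookup_mult_0\<close>)
qed

lemma rat_series_sum: "(\<And>i. i \<in> I \<Longrightarrow> f i \<in> rat_series V) \<Longrightarrow> (\<Sum>i\<in>I. f i) \<in> rat_series V"
  by (induction I rule: infinite_finite_induct) (auto intro: rat_series_add)

definition var :: "'v \<Rightarrow> 'v series" where
  "var v = series_of_poly (mvar v)"

lemma rat_series_var: "v \<in> V \<Longrightarrow> var v \<in> rat_series V"
  by (simp add: var_def rat_series_poly mpolys_mvar)

lemma single_1_neq_0: "Poly_Mapping.single v (1::nat) \<noteq> 0"
  by (metis lookup_single_eq lookup_zero one_neq_zero)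

text \<open>If \<open>r = P / Q\<close>, then \<open>1 - t r = (Q - t P) / Q\<close>, and the numerator \<open>Q - t P\<close> again has
  constant coefficient 1.\<close>
lemma rat_series_divide:
  assumes "(1 - var t * r) * h = g" "t \<in> V" "r \<in> rat_series V" "g \<in> rat_series V"
  shows "h \<in> rat_series V"
proof -
  obtain P Q P' Q' where
    *: "P \<in> mpolys V" "Q \<in> mpolys V" "Poly_Mapping.lookup Q 0 = 1"
      "P' \<in> mpolys V" "Q' \<in> mpolys V" "Poly_Mapping.lookup Q' 0 = 1"
    and e: "series_of_poly Q * r = series_of_poly P" "series_of_poly Q' * g = series_of_poly P'"
    using assms(3,4) by (elim rat_seriesE)
  have "series_of_poly (Q' * (Q - mvar t * P)) * h
      = series_of_poly Q' * (series_of_poly Q - var t * (series_of_poly Q * r)) * h"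
    by (simp add: series_of_poly_hom e var_def)
  also have "\<dots> = series_of_poly Q * (series_of_poly Q' * ((1 - var t * r) * h))"
    by (simp add: algebra_simps)
  also have "\<dots> = series_of_poly (Q * P')"
    by (simp add: assms(1) e series_of_poly_hom)
  finally have "series_of_poly (Q' * (Q - mvar t * P)) * h = series_of_poly (Q * P')" .
  moreover have "Poly_Mapping.lookup (mvar t :: ('a, rat) mpoly) 0 = 0"
    using single_1_neq_0[of t] by (simp add: mvar_def lookup_single when_def)
  ultimately show ?thesis
    by (intro rat_seriesI)
      (use * assms(2) in \<open>auto intro!: mpolys_mult mpolys_diff mpolys_mvar
        simp: lookup_mult_0 lookup_minus\<close>)
qed

text \<open>Gaussian elimination for \<open>w = g + t M w\<close>. Pivots never vanish, because they have the form
  \<open>1 - t r\<close>. The row of \<open>x\<close> reads \<open>(1 - t M\<^sub>x\<^sub>x) w\<^sub>x = \<dots>\<close>; multiplying another row by this pivot lets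
  \<open>w\<^sub>x\<close> be replaced, and the resulting coefficient \<open>1 - t M\<^sub>x\<^sub>x\<close> of \<open>w\<^sub>i\<close> on the left is absorbed into the
  diagonal of the new matrix. So no inverse of the pivot is needed and the smaller system has the
  same shape.\<close>
lemma linear_system_rat_series:
  assumes "finite I" "t \<in> V"
    and "\<And>i. i \<in> I \<Longrightarrow> g i \<in> rat_series V"
    and "\<And>i l. i \<in> I \<Longrightarrow> l \<in> I \<Longrightarrow> M i l \<in> rat_series V"
    and "\<And>i. i \<in> I \<Longrightarrow> w i = g i + var t * (\<Sum>l\<in>I. M i l * w l)"
    and "i \<in> I"
  shows "w i \<in> rat_series V"
  using assms(1,3-)
proof (induction I arbitrary: g M i rule: finite_induct)
  case (insert x I)
  let ?p = "1 - var t * M x x"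
  let ?g = "\<lambda>i. ?p * g i + var t * M i x * g x"
  let ?M = "\<lambda>i l. ?p * M i l + var t * M i x * M x l + (if i = l then M x x else 0)"
  have p: "?p \<in> rat_series V"
    using rat_series_add[OF rat_series_1, of "- var t * M x x"]
      rat_series_mult[OF rat_series_mult[OF rat_series_poly[OF mpolys_uminus[OF mpolys_one]]
        rat_series_var[OF \<open>t \<in> V\<close>]] insert.prems(2)[of x x]]
    by (simp add: series_of_poly_hom(2)[of 0 1, simplified] series_of_poly_hom)
  have x: "?p * w x = g x + var t * (\<Sum>l\<in>I. M x l * w l)"
    using insert.prems(3)[of x] insert.hyps by (simp add: algebra_simps)
  have "w i \<in> rat_series V" if i: "i \<in> I" for i
  proof (rule insert.IH[where g = ?g and M = ?M])
    fix i assume i: "i \<in> I"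
    have "w i = g i + var t * (\<Sum>l\<in>I. M i l * w l) + var t * M i x * w x"
      using insert.prems(3)[of i] i insert.hyps by (simp add: algebra_simps)
    then have "?p * w i = ?p * g i + var t * (\<Sum>l\<in>I. ?p * M i l * w l)
        + var t * M i x * (?p * w x)"
      by (simp add: algebra_simps sum_distrib_left sum_subtractf)
    also have "\<dots> = ?g i
        + var t * (\<Sum>l\<in>I. (?p * M i l + var t * M i x * M x l) * w l)"
      unfolding x by (simp only: distrib_right distrib_left sum.distrib sum_distrib_left ac_simps)
    finally have "w i = ?g i
        + var t * (\<Sum>l\<in>I. (?p * M i l + var t * M i x * M x l) * w l) + var t * (M x x * w i)"
      by (simp add: algebra_simps)
    moreover have "(\<Sum>l\<in>I. (if i = l then M x x else 0) * w l) = M x x * w i"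
      using i insert.hyps by (simp add: if_distribR if_distrib[where f = "\<lambda>a. a * _"] cong: if_cong)
    ultimately show "w i = ?g i + var t * (\<Sum>l\<in>I. ?M i l * w l)"
      by (simp add: distrib_right distrib_left sum.distrib add.assoc)
  qed (use p i insert.prems(1,2) \<open>t \<in> V\<close> in
      \<open>auto intro!: rat_series_add rat_series_mult rat_series_var\<close>)
  moreover have "w x \<in> rat_series V"
    by (rule rat_series_divide[OF x \<open>t \<in> V\<close>])
      (use calculation insert.prems(1,2) \<open>t \<in> V\<close> in
        \<open>auto intro!: rat_series_add rat_series_mult rat_series_var rat_series_sum\<close>)
  ultimately show ?case using insert.prems(4) by auto
qed simp

section \<open>Recurrent sequences of power series\<close>

lemma coef_var_mult:
  "coef (var k * h) e = (if Poly_Mapping.lookup e k = 0 then 0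
     else coef h (e - Poly_Mapping.single k 1))"
proof -
  let ?s = "Poly_Mapping.single k (1 :: nat)"
  have var: "coef (var k) a = (if a = ?s then 1 else 0)" for a
    by (simp add: var_def mvar_def lookup_single when_def)
  have sum: "coef (var k * h) e = (\<Sum>(a, b)\<in>{x \<in> splittings e. fst x = ?s}. coef h b)"
    unfolding coef_mult
    by (rule sum.mono_neutral_cong_right) (auto simp: finite_mono_splittings var split: if_splits)
  show ?thesis
  proof (cases "Poly_Mapping.lookup e k = 0")
    case True
    then have "a + b = e \<Longrightarrow> a \<noteq> ?s" for a b
      by (auto simp: lookup_add)
    then have "(\<Sum>(a, b)\<in>{x \<in> splittings e. fst x = ?s}. coef h b) = 0"
      by (intro sum.neutral) auto
    with sum have "coef (var k * h) e = 0" by (rule trans)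
    then show ?thesis using True by simp
  next
    case False
    then have "?s + (e - ?s) = e"
      by (intro poly_mapping_eqI) (auto simp: lookup_add lookup_minus lookup_single when_def)
    then have "{x \<in> splittings e. fst x = ?s} = {(?s, e - ?s)}"
      by auto
    then show ?thesis using False sum by (simp only:) simp
  qed
qed

lemma coef_var_power_mult:
  "coef (var k ^ d * h) e = (if d \<le> Poly_Mapping.lookup e k
     then coef h (e - Poly_Mapping.single k d) else 0)"
proof (induction d arbitrary: e)
  case (Suc d)
  have "e - Poly_Mapping.single k 1 - Poly_Mapping.single k d = e - Poly_Mapping.single k (Suc d)"
    by (intro poly_mapping_eqI) (auto simp: lookup_minus lookup_single when_def)
  moreover have "coef (var k ^ Suc d * h) e = coef (var k * (var k ^ d * h)) e"
    by (simp add: mult.assoc)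
  ultimately show ?case
    unfolding coef_var_mult Suc by (auto simp: lookup_minus)
qed simp

text \<open>The series \<open>\<Sum>\<^sub>d t\<^sup>d a\<^sub>d\<close>. A coefficient is computed from finitely many terms, since \<open>t\<^sup>d a\<^sub>d\<close> only
  contributes to exponents that are at least \<open>d\<close> in \<open>t\<close>; the \<open>a\<^sub>d\<close> themselves may contain \<open>t\<close>.\<close>
definition power_sum :: "'v \<Rightarrow> (nat \<Rightarrow> 'v series) \<Rightarrow> 'v series" where
  "power_sum t a = Series (\<lambda>e. \<Sum>d\<le>Poly_Mapping.lookup e t. coef (var t ^ d * a d) e)"

lemma coef_power_sum_trunc:
  assumes "Poly_Mapping.lookup e t \<le> D"
  shows "coef (power_sum t a) e = coef (\<Sum>d\<le>D. var t ^ d * a d) e"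
  unfolding power_sum_def Series_inverse[OF UNIV_I] coef_sum
  by (rule sum.mono_neutral_left) (use assms in \<open>auto simp: coef_var_power_mult\<close>)

lemma power_sum_scale: "power_sum t (\<lambda>d. r * a d) = r * power_sum t a"
proof (rule series_eqI)
  fix e :: "'a \<Rightarrow>\<^sub>0 nat"
  let ?D = "Poly_Mapping.lookup e t"
  have "coef (power_sum t (\<lambda>d. r * a d)) e = coef (r * (\<Sum>d\<le>?D. var t ^ d * a d)) e"
    by (simp add: coef_power_sum_trunc[of e t ?D] sum_distrib_left mult.left_commute)
  also have "\<dots> = (\<Sum>(x, y)\<in>splittings e. coef r x * coef (power_sum t a) y)"
    unfolding coef_mult
    by (rule sum.cong) (auto simp: coef_power_sum_trunc[of _ t ?D] lookup_add)
  finally show "coef (power_sum t (\<lambda>d. r * a d)) e = coef (r * power_sum t a) e"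
    by (simp add: coef_mult)
qed

lemma power_sum_sum: "power_sum t (\<lambda>d. \<Sum>i\<in>I. a i d) = (\<Sum>i\<in>I. power_sum t (a i))"
proof (rule series_eqI)
  fix e :: "'a \<Rightarrow>\<^sub>0 nat"
  show "coef (power_sum t (\<lambda>d. \<Sum>i\<in>I. a i d)) e = coef (\<Sum>i\<in>I. power_sum t (a i)) e"
    by (simp add: coef_power_sum_trunc[of e t "Poly_Mapping.lookup e t"] sum_distrib_left)
      (rule sum.swap)
qed

lemma power_sum_unfold: "power_sum t a = a 0 + var t * power_sum t (\<lambda>d. a (Suc d))"
proof (rule series_eqI)
  fix e :: "'a \<Rightarrow>\<^sub>0 nat"
  let ?D = "Poly_Mapping.lookup e t"
  have "coef (power_sum t a) e = coef (a 0 + var t * (\<Sum>d\<le>?D. var t ^ d * a (Suc d))) e"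
    by (simp add: coef_power_sum_trunc[of e t "Suc ?D"] sum.atMost_Suc_shift sum_distrib_left
        mult.assoc del: sum.atMost_Suc)
  moreover have "coef (var t * (\<Sum>d\<le>?D. var t ^ d * a (Suc d))) e
      = (\<Sum>(x, y)\<in>splittings e. coef (var t) x * coef (power_sum t (\<lambda>d. a (Suc d))) y)"
    unfolding coef_mult
    by (rule sum.cong) (auto simp: coef_power_sum_trunc[of _ t ?D] lookup_add)
  ultimately show "coef (power_sum t a) e = coef (a 0 + var t * power_sum t (\<lambda>d. a (Suc d))) e"
    by (simp add: coef_mult)
qed

text \<open>The sequences \<open>a\<close> that are a component of a sequence of vectors \<open>v 0, M v 0, M\<^sup>2 v 0, \<dots>\<close> with a
  rational initial vector and a constant rational matrix.\<close>
definition recurrent :: "'v set \<Rightarrow> (nat \<Rightarrow> 'v series) \<Rightarrow> bool" where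
  "recurrent V a \<longleftrightarrow> (\<exists>(I :: nat set) M v. finite I \<and>
     (\<forall>i\<in>I. \<forall>l\<in>I. M i l \<in> rat_series V) \<and> (\<forall>i\<in>I. v i 0 \<in> rat_series V) \<and>
     (\<forall>i\<in>I. \<forall>d. v i (Suc d) = (\<Sum>l\<in>I. M i l * v l d)) \<and> a \<in> v ` I)"

lemma recurrentE:
  assumes "recurrent V a"
  obtains I :: "nat set" and M v i where "finite I"
    "\<And>i l. i \<in> I \<Longrightarrow> l \<in> I \<Longrightarrow> M i l \<in> rat_series V" "\<And>i. i \<in> I \<Longrightarrow> v i 0 \<in> rat_series V"
    "\<And>i d. i \<in> I \<Longrightarrow> v i (Suc d) = (\<Sum>l\<in>I. M i l * v l d)" "i \<in> I" "a = v i"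
proof -
  from assms obtain I :: "nat set" and M v where
    "finite I \<and> (\<forall>i\<in>I. \<forall>l\<in>I. M i l \<in> rat_series V) \<and> (\<forall>i\<in>I. v i 0 \<in> rat_series V) \<and>
     (\<forall>i\<in>I. \<forall>d. v i (Suc d) = (\<Sum>l\<in>I. M i l * v l d)) \<and> a \<in> v ` I"
    unfolding recurrent_def by (elim exE)
  then show thesis
    by (elim conjE imageE) (rule that[of I M v], simp_all)
qed

text \<open>Summing \<open>v (d + 1) = M v d\<close> against \<open>t\<^sup>d\<close> gives the linear system \<open>w = v 0 + t M w\<close> for the generating
  series \<open>w\<close> of the vector \<open>v\<close>.\<close>
lemma power_sum_rat_series:
  assumes "recurrent V a" "t \<in> V"
  shows "power_sum t a \<in> rat_series V"
proof -
  obtain I :: "nat set" and M v i where *: "finite I"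
      "\<And>i l. i \<in> I \<Longrightarrow> l \<in> I \<Longrightarrow> M i l \<in> rat_series V" "\<And>i. i \<in> I \<Longrightarrow> v i 0 \<in> rat_series V"
      "\<And>i d. i \<in> I \<Longrightarrow> v i (Suc d) = (\<Sum>l\<in>I. M i l * v l d)" "i \<in> I" "a = v i"
    using assms(1) by (rule recurrentE) (rule that)
  have eq: "power_sum t (v i) = v i 0 + var t * (\<Sum>l\<in>I. M i l * power_sum t (v l))" if "i \<in> I" for i
    using that by (subst power_sum_unfold) (simp add: *(4) power_sum_sum power_sum_scale)
  show ?thesis
    unfolding \<open>a = v i\<close>
    by (rule linear_system_rat_series[OF *(1) assms(2) *(3) *(2) eq *(5)])
qed

lemma recurrent_1: "recurrent V (\<lambda>_. 1)"
  unfolding recurrent_def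
  by (rule exI[of _ "{0}"], rule exI[of _ "\<lambda>_ _. 1"], rule exI[of _ "\<lambda>_ _. 1"]) simp

text \<open>The vector \<open>v d \<otimes> w d\<close> satisfies the recurrence with matrix \<open>M \<otimes> N\<close>.\<close>
lemma recurrent_mult:
  assumes "recurrent V a" "recurrent V b"
  shows "recurrent V (\<lambda>d. a d * b d)"
proof -
  obtain I :: "nat set" and M v i where I: "finite I"
      "\<And>i l. i \<in> I \<Longrightarrow> l \<in> I \<Longrightarrow> M i l \<in> rat_series V" "\<And>i. i \<in> I \<Longrightarrow> v i 0 \<in> rat_series V"
      "\<And>i d. i \<in> I \<Longrightarrow> v i (Suc d) = (\<Sum>l\<in>I. M i l * v l d)" "i \<in> I" "a = v i"
    using assms(1) by (rule recurrentE) (rule that)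
  obtain J :: "nat set" and N w j where J: "finite J"
      "\<And>i l. i \<in> J \<Longrightarrow> l \<in> J \<Longrightarrow> N i l \<in> rat_series V" "\<And>i. i \<in> J \<Longrightarrow> w i 0 \<in> rat_series V"
      "\<And>i d. i \<in> J \<Longrightarrow> w i (Suc d) = (\<Sum>l\<in>J. N i l * w l d)" "j \<in> J" "b = w j"
    using assms(2) by (rule recurrentE) (rule that)
  \<comment> \<open>Index sets consist of natural numbers, so pairs of indices are encoded.\<close>
  let ?K = "prod_encode ` (I \<times> J)"
  let ?M = "\<lambda>x y. M (fst (prod_decode x)) (fst (prod_decode y))
    * N (snd (prod_decode x)) (snd (prod_decode y))"
  let ?v = "\<lambda>x d. v (fst (prod_decode x)) d * w (snd (prod_decode x)) d"
  have "?v x (Suc d) = (\<Sum>y\<in>?K. ?M x y * ?v y d)" if x: "x \<in> ?K" for x d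
  proof -
    obtain k l where kl: "k \<in> I" "l \<in> J" "x = prod_encode (k, l)" using x by auto
    have "?v x (Suc d) = (\<Sum>(p, q)\<in>I \<times> J. (M k p * v p d) * (N l q * w q d))"
      using kl by (simp add: I(4) J(4) sum_product sum.cartesian_product)
    also have "\<dots> = (\<Sum>y\<in>?K. ?M x y * ?v y d)"
      using kl by (subst sum.reindex) (auto simp: inj_prod_encode intro!: sum.cong)
    finally show ?thesis .
  qed
  moreover have "(\<lambda>d. a d * b d) \<in> ?v ` ?K"
    by (rule image_eqI[of _ _ "prod_encode (i, j)"]) (use I J in auto)
  ultimately show ?thesis
    unfolding recurrent_def
    by (intro exI[of _ ?K] exI[of _ ?M] exI[of _ ?v] conjI)
      (use I J in \<open>auto intro!: rat_series_mult\<close>)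
qed

lemma recurrent_prod:
  "(\<And>i. i \<in> I \<Longrightarrow> recurrent V (a i)) \<Longrightarrow> recurrent V (\<lambda>d. \<Prod>i\<in>I. a i d)"
  by (induction I rule: infinite_finite_induct) (auto intro: recurrent_1 recurrent_mult)

section \<open>Series in separated variables\<close>

definition univariate :: "'v \<Rightarrow> (nat \<Rightarrow> rat) \<Rightarrow> 'v series" where
  "univariate k g = Series (\<lambda>e. if Poly_Mapping.keys e \<subseteq> {k} then g (Poly_Mapping.lookup e k) else 0)"

lemma coef_univariate:
  "coef (univariate k g) e
    = (if Poly_Mapping.keys e \<subseteq> {k} then g (Poly_Mapping.lookup e k) else 0)"
  by (simp add: univariate_def)

text \<open>An exponent splits in only one way into parts supported on the single variables, so the
  coefficients of a product of series in separate variables are products of coefficients.\<close>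
lemma coef_prod_univariate:
  assumes "finite K"
  shows "coef (\<Prod>k\<in>K. univariate k (g k)) e
    = (if Poly_Mapping.keys e \<subseteq> K then \<Prod>k\<in>K. g k (Poly_Mapping.lookup e k) else 0)"
  using assms
proof (induction K arbitrary: e rule: finite_induct)
  case empty
  then show ?case by (simp add: coef_one)
next
  case (insert x K)
  let ?A = "\<Prod>k\<in>K. univariate k (g k)"
  let ?s = "Poly_Mapping.single x (Poly_Mapping.lookup e x)"
  have "coef (\<Prod>k\<in>insert x K. univariate k (g k)) e
      = (\<Sum>(a, b)\<in>splittings e. coef (univariate x (g x)) a * coef ?A b)"
    using insert.hyps by (simp add: coef_mult)
  also have "\<dots> = (\<Sum>(a, b)\<in>{(a, b). a + b = e \<and> Poly_Mapping.keys a \<subseteq> {x} \<and> Poly_Mapping.keys b \<subseteq> K}.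
      g x (Poly_Mapping.lookup a x) * (\<Prod>k\<in>K. g k (Poly_Mapping.lookup b k)))"
    by (rule sum.mono_neutral_cong_right)
      (auto simp: finite_mono_splittings coef_univariate insert.IH split: if_splits)
  also have "\<dots> = (if Poly_Mapping.keys e \<subseteq> insert x K
      then \<Prod>k\<in>insert x K. g k (Poly_Mapping.lookup e k) else 0)"
  proof (cases "Poly_Mapping.keys e \<subseteq> insert x K")
    case True
    have s: "?s + (e - ?s) = e"
      by (intro poly_mapping_eqI) (auto simp: lookup_add lookup_minus lookup_single when_def)
    have l: "Poly_Mapping.lookup (e - ?s) k = (if k = x then 0 else Poly_Mapping.lookup e k)" for k
      by (simp add: lookup_minus lookup_single when_def)
    have "a = ?s" if "a + b = e" "Poly_Mapping.keys a \<subseteq> {x}" "Poly_Mapping.keys b \<subseteq> K" for a b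
    proof (rule poly_mapping_eqI)
      fix k
      have "Poly_Mapping.lookup b x = 0" using that insert.hyps by (auto simp: in_keys_iff)
      moreover have "Poly_Mapping.lookup a k = 0" if "k \<noteq> x"
        using that \<open>Poly_Mapping.keys a \<subseteq> {x}\<close> by (auto simp: in_keys_iff)
      ultimately show "Poly_Mapping.lookup a k = Poly_Mapping.lookup ?s k"
        using that(1) by (auto simp: lookup_single when_def lookup_add)
    qed
    then have "(a, b) = (?s, e - ?s)"
      if "a + b = e" "Poly_Mapping.keys a \<subseteq> {x}" "Poly_Mapping.keys b \<subseteq> K" for a b
      using that by (metis add_diff_cancel_left')
    moreover have "Poly_Mapping.keys ?s \<subseteq> {x}" "Poly_Mapping.keys (e - ?s) \<subseteq> K"
      using True by (auto simp: in_keys_iff l subset_iff split: if_splits)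
    ultimately have "{(a, b). a + b = e \<and> Poly_Mapping.keys a \<subseteq> {x} \<and> Poly_Mapping.keys b \<subseteq> K} = {(?s, e - ?s)}"
      using s by blast
    moreover have "(\<Prod>k\<in>K. g k (Poly_Mapping.lookup (e - ?s) k)) = (\<Prod>k\<in>K. g k (Poly_Mapping.lookup e k))"
      using insert.hyps by (intro prod.cong) (auto simp: l)
    ultimately show ?thesis using True insert.hyps by simp
  next
    case False
    then have "{(a, b). a + b = e \<and> Poly_Mapping.keys a \<subseteq> {x} \<and> Poly_Mapping.keys b \<subseteq> K} = {}"
      by (auto simp: keys_add_nat)
    then show ?thesis using False by (simp only: sum.empty if_False)
  qed
  finally show ?case .
qed

definition multichoose :: "nat \<Rightarrow> nat \<Rightarrow> nat" where
  "multichoose n d = (n + d - 1) choose d"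

lemma multichoose_0 [simp]: "multichoose n 0 = 1"
  and multichoose_0_Suc [simp]: "multichoose 0 (Suc d) = 0"
  and multichoose_Suc_Suc:
    "multichoose (Suc n) (Suc d) = multichoose n (Suc d) + multichoose (Suc n) d"
  by (simp_all add: multichoose_def)

lemma multichoose_add_Suc:
  "multichoose (n + e) (Suc d) = multichoose n (Suc d) + (\<Sum>f=1..e. multichoose (n + f) d)"
  by (induction e) (simp_all add: multichoose_Suc_Suc)

lemma rat_series_of_nat [simp]: "of_nat n \<in> rat_series V"
  by (induction n) (auto intro: rat_series_add)

text \<open>The vector consists of \<open>multichoose e d\<close> for all \<open>e \<le> n\<close>. Iterating Pascal's rule expresses each
  entry at \<open>d + 1\<close> as a partial sum of the entries at \<open>d\<close>.\<close>
lemma recurrent_multichoose: "recurrent V (\<lambda>d. of_nat (multichoose n d))"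
  unfolding recurrent_def
proof (intro exI conjI)
  let ?M = "\<lambda>e f. if f \<in> {1..e} then 1 else 0"
  let ?v = "\<lambda>e d. of_nat (multichoose e d)"
  show "\<forall>i\<in>{0..n}. \<forall>d. ?v i (Suc d) = (\<Sum>l\<in>{0..n}. ?M i l * ?v l d)"
  proof (intro ballI allI)
    fix i d assume "i \<in> {0..n}"
    then have "(\<Sum>l\<in>{0..n}. ?M i l * ?v l d) = (\<Sum>l\<in>{1..i}. ?v l d)"
      by (intro sum.mono_neutral_cong_right) auto
    also have "\<dots> = ?v i (Suc d)"
      using multichoose_add_Suc[of 0 i d] by simp
    finally show "?v i (Suc d) = (\<Sum>l\<in>{0..n}. ?M i l * ?v l d)" ..
  qed
qed auto

text \<open>Put \<open>V\<^sub>e d = \<Sum>\<^sub>n\<^sub>\<ge>\<^sub>1 multichoose (c (n - 1) + e) d s\<^sup>n\<close> for \<open>e \<le> c\<close>; the series in question is \<open>V\<^sub>c d\<close>.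
  Pascal's rule gives \<open>V\<^sub>e (d + 1) = V\<^sub>0 (d + 1) + \<Sum>\<^sub>1\<^sub>\<le>\<^sub>f\<^sub>\<le>\<^sub>e V\<^sub>f d\<close>. The index \<open>n\<close> moves on by one when \<open>e\<close> runs
  from 0 to \<open>c\<close>, so \<open>V\<^sub>0 (d + 1) = s V\<^sub>c (d + 1)\<close>. For \<open>e = c\<close> these two relations yield
  \<open>(1 - s) V\<^sub>c (d + 1) = \<Sum>\<^sub>1\<^sub>\<le>\<^sub>f\<^sub>\<le>\<^sub>c V\<^sub>f d\<close>, and then all \<open>V\<^sub>e (d + 1)\<close> are expressed by the \<open>V\<^sub>f d\<close>; the matrix
  has the only denominator \<open>1 - s\<close>.\<close>
lemma recurrent_univariate_multichoose:
  assumes "k \<in> V"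
  shows "recurrent V (\<lambda>d. univariate k (\<lambda>n. if n = 0 then 0 else of_nat (multichoose (c * n) d)))"
  unfolding recurrent_def
proof (intro exI conjI)
  let ?J = "univariate k (\<lambda>_. 1)"
  let ?M = "\<lambda>e f. if f = 0 then 0 else (if f \<le> e then 1 else 0) + var k * ?J"
  let ?g = "\<lambda>e d n. if n = 0 then 0 else rat_of_nat (multichoose (c * (n - 1) + e) d)"
  let ?v = "\<lambda>e d. univariate k (?g e d)"
  have shift: "var k * univariate k g = univariate k (\<lambda>n. if n = 0 then 0 else g (n - 1))" for g
  proof (rule series_eqI)
    fix e :: "'a \<Rightarrow>\<^sub>0 nat"
    have l: "Poly_Mapping.lookup (e - Poly_Mapping.single k 1) i
        = (if i = k then Poly_Mapping.lookup e k - 1 else Poly_Mapping.lookup e i)" for i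
      by (simp add: lookup_minus lookup_single when_def)
    have "Poly_Mapping.keys (e - Poly_Mapping.single k 1) \<subseteq> {k} \<longleftrightarrow> Poly_Mapping.keys e \<subseteq> {k}"
      unfolding subset_iff in_keys_iff l by auto
    then show "coef (var k * univariate k g) e
        = coef (univariate k (\<lambda>n. if n = 0 then 0 else g (n - 1))) e"
      unfolding coef_var_mult coef_univariate l by simp
  qed
  have add: "univariate k g + univariate k h = univariate k (\<lambda>n. g n + h n)" for g h
    by (rule series_eqI) (auto simp: coef_univariate)
  have sum: "(\<Sum>i\<in>I. univariate k (g i)) = univariate k (\<lambda>n. \<Sum>i\<in>I. g i n)" for g and I :: "nat set"
    by (rule series_eqI) (auto simp: coef_univariate)
  have J: "univariate k (\<lambda>_. 1) = 1 + var k * ?J"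
    unfolding shift
  proof (rule series_eqI)
    fix e :: "'a \<Rightarrow>\<^sub>0 nat"
    have "e = 0" if "Poly_Mapping.keys e \<subseteq> {k}" "Poly_Mapping.lookup e k = 0"
      using that by (intro poly_mapping_eqI) (auto simp: in_keys_iff subset_iff)
    then show "coef (univariate k (\<lambda>_. 1)) e = coef (1 + univariate k (\<lambda>n. if n = 0 then 0 else 1)) e"
      by (auto simp: coef_univariate coef_one)
  qed
  then have J': "?J - var k * ?J = 1" by (metis add_diff_cancel_right')
  then have "(1 - var k * 1) * ?J = 1" by (simp add: left_diff_distrib)
  then have J_rat: "?J \<in> rat_series V"
    using assms by (rule rat_series_divide) auto
  have step: "?v e (Suc d) = ?v 0 (Suc d) + (\<Sum>f\<in>{1..e}. ?v f d)" for e d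
    unfolding sum add by (rule arg_cong[of _ _ "univariate k"]) (auto simp: fun_eq_iff multichoose_add_Suc)
  \<comment> \<open>Raising \<open>e\<close> by \<open>c\<close> is the same as raising \<open>n\<close> by one;
    the term \<open>n = 1\<close> vanishes as \<open>multichoose 0 (d + 1) = 0\<close>.\<close>
  have wrap: "?v 0 (Suc d) = var k * ?v c (Suc d)" for d
  proof -
    have eq: "?g 0 (Suc d) n = (if n = 0 then 0 else ?g c (Suc d) (n - 1))" for n
      by (cases n; cases "n - 1") (auto simp: algebra_simps)
    show ?thesis unfolding shift by (rule arg_cong[of _ _ "univariate k"], rule ext) (rule eq)
  qed
  have top: "?v c (Suc d) = ?J * (\<Sum>f\<in>{1..c}. ?v f d)" for d
  proof -
    have "?v c (Suc d) = var k * ?v c (Suc d) + (\<Sum>f\<in>{1..c}. ?v f d)"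
      using step[of c d] wrap[of d] by simp
    then have "?J * ?v c (Suc d) = ?J * (var k * ?v c (Suc d) + (\<Sum>f\<in>{1..c}. ?v f d))"
      by simp
    then have "(?J - var k * ?J) * ?v c (Suc d) = ?J * (\<Sum>f\<in>{1..c}. ?v f d)"
      by (simp add: algebra_simps)
    then show ?thesis unfolding J' by simp
  qed
  show "\<forall>i\<in>{0..c}. \<forall>d. ?v i (Suc d) = (\<Sum>l\<in>{0..c}. ?M i l * ?v l d)"
  proof (intro ballI allI)
    fix i d assume i: "i \<in> {0..c}"
    have "(\<Sum>l\<in>{0..c}. ?M i l * ?v l d)
        = (\<Sum>l\<in>{1..c}. (if l \<le> i then ?v l d else 0) + var k * ?J * ?v l d)"
      by (intro sum.mono_neutral_cong_right) (auto simp: algebra_simps)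
    also have "\<dots> = (\<Sum>l\<in>{1..c}. if l \<le> i then ?v l d else 0) + var k * (?J * (\<Sum>l\<in>{1..c}. ?v l d))"
      by (simp only: sum.distrib sum_distrib_left mult.assoc)
    also have "(\<Sum>l\<in>{1..c}. if l \<le> i then ?v l d else 0) = (\<Sum>l\<in>{1..i}. ?v l d)"
      using i by (intro sum.mono_neutral_cong_right) auto
    finally show "?v i (Suc d) = (\<Sum>l\<in>{0..c}. ?M i l * ?v l d)"
      using step[of i d] wrap[of d] top[of d] by simp
  qed
  show "\<forall>i\<in>{0..c}. ?v i 0 \<in> rat_series V"
    using shift[of "\<lambda>_. 1"] rat_series_mult[OF rat_series_var[OF assms] J_rat]
    by (simp cong: if_cong)
  show "\<forall>i\<in>{0..c}. \<forall>l\<in>{0..c}. ?M i l \<in> rat_series V"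
    using J_rat assms by (auto intro!: rat_series_add rat_series_mult rat_series_var)
  have "?v c = (\<lambda>d. univariate k (\<lambda>n. if n = 0 then 0 else of_nat (multichoose (c * n) d)))"
    by (rule ext, rule arg_cong[of _ _ "univariate k"]) (auto simp: fun_eq_iff algebra_simps gr0_conv_Suc)
  then show "(\<lambda>d. univariate k (\<lambda>n. if n = 0 then 0 else of_nat (multichoose (c * n) d))) \<in> ?v ` {0..c}"
    by (intro image_eqI[of _ _ c]) (rule sym, assumption, simp)
qed auto

text \<open>The power series half of the argument: the coefficient of \<open>t\<^sup>d \<Prod>\<^sub>k s\<^sub>k ^ n\<^sub>k\<close> is a product of factors
  that depend on \<open>d\<close> and on at most one of the \<open>n\<^sub>k\<close>.\<close>
lemma rational_multichoose_product:
  assumes "finite K" "t \<notin> K"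
  shows "rational_mseries (insert t K) (\<lambda>e.
    if Poly_Mapping.keys e \<subseteq> insert t K \<and> (\<forall>k\<in>K. Poly_Mapping.lookup e k \<ge> 1)
    then of_nat ((\<Prod>k\<in>K. multichoose (c k * Poly_Mapping.lookup e k) (Poly_Mapping.lookup e t))
      * (\<Prod>j\<in>J. multichoose (N j) (Poly_Mapping.lookup e t)))
    else 0)"
proof -
  let ?V = "insert t K"
  let ?g = "\<lambda>d k n. if n = 0 then 0 else rat_of_nat (multichoose (c k * n) d)"
  let ?a = "\<lambda>d. \<Prod>k\<in>K. univariate k (?g d k)"
  let ?b = "\<lambda>d. \<Prod>j\<in>J. of_nat (multichoose (N j) d)"
  have "recurrent ?V (\<lambda>d. ?a d * ?b d)"
    by (intro recurrent_mult recurrent_prod recurrent_multichoose recurrent_univariate_multichoose) auto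
  then have "rational_mseries ?V (coef (power_sum t (\<lambda>d. ?a d * ?b d)))"
    by (intro rational_mseries_if_rat_series power_sum_rat_series) auto
  also have "coef (power_sum t (\<lambda>d. ?a d * ?b d)) = (\<lambda>e.
    if Poly_Mapping.keys e \<subseteq> insert t K \<and> (\<forall>k\<in>K. Poly_Mapping.lookup e k \<ge> 1)
    then of_nat ((\<Prod>k\<in>K. multichoose (c k * Poly_Mapping.lookup e k) (Poly_Mapping.lookup e t))
      * (\<Prod>j\<in>J. multichoose (N j) (Poly_Mapping.lookup e t)))
    else 0)"
  proof
    fix e :: "'a \<Rightarrow>\<^sub>0 nat"
    let ?n = "Poly_Mapping.lookup e t"
    let ?e = "\<lambda>d. e - Poly_Mapping.single t d"
    have coef_ab: "coef (?a d * ?b d) x = (if Poly_Mapping.keys x \<subseteq> K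
        then (\<Prod>k\<in>K. ?g d k (Poly_Mapping.lookup x k)) * (\<Prod>j\<in>J. of_nat (multichoose (N j) d)) else 0)"
      for d x
    proof -
      have "coef (f * of_nat n) x = coef f x * of_nat n" for f and n :: nat
        by (induction n) (auto simp: algebra_simps)
      then show ?thesis
        using coef_prod_univariate[OF \<open>finite K\<close>, of "?g d" x]
        by (simp flip: of_nat_prod)
    qed
    have l: "Poly_Mapping.lookup (?e d) k = (if k = t then ?n - d else Poly_Mapping.lookup e k)" for k d
      by (simp add: lookup_minus lookup_single when_def)
    have "coef (power_sum t (\<lambda>d. ?a d * ?b d)) e = (\<Sum>d\<le>?n. coef (?a d * ?b d) (?e d))"
      unfolding power_sum_def Series_inverse[OF UNIV_I] by (rule sum.cong) (auto simp: coef_var_power_mult)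
    also have "\<dots> = (\<Sum>d\<in>{?n}. coef (?a d * ?b d) (?e d))"
    proof (rule sum.mono_neutral_right)
      have "t \<in> Poly_Mapping.keys (?e d)" if "d < ?n" for d
        using that by (simp add: in_keys_iff l)
      then show "\<forall>d\<in>{..?n} - {?n}. coef (?a d * ?b d) (?e d) = 0"
        using assms(2) by (auto simp: coef_ab) (metis le_neq_implies_less subsetD)
    qed auto
    also have "\<dots> = coef (?a ?n * ?b ?n) (?e ?n)"
      by simp
    also have "\<dots> = (if Poly_Mapping.keys (?e ?n) \<subseteq> K
        then (\<Prod>k\<in>K. ?g ?n k (Poly_Mapping.lookup (?e ?n) k)) * (\<Prod>j\<in>J. of_nat (multichoose (N j) ?n)) else 0)"
      by (rule coef_ab)
    also have "Poly_Mapping.keys (?e ?n) \<subseteq> K \<longleftrightarrow> Poly_Mapping.keys e \<subseteq> insert t K"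
      using assms(2) by (auto simp: in_keys_iff l subset_iff)
    also have "(\<Prod>k\<in>K. ?g ?n k (Poly_Mapping.lookup (?e ?n) k)) = (\<Prod>k\<in>K. ?g ?n k (Poly_Mapping.lookup e k))"
      using assms(2) by (intro prod.cong) (auto simp: l)
    also have "(if Poly_Mapping.keys e \<subseteq> insert t K
        then (\<Prod>k\<in>K. ?g ?n k (Poly_Mapping.lookup e k)) * (\<Prod>j\<in>J. of_nat (multichoose (N j) ?n)) else 0)
      = (if Poly_Mapping.keys e \<subseteq> insert t K \<and> (\<forall>k\<in>K. Poly_Mapping.lookup e k \<ge> 1)
      then of_nat ((\<Prod>k\<in>K. multichoose (c k * Poly_Mapping.lookup e k) ?n)
        * (\<Prod>j\<in>J. multichoose (N j) ?n)) else 0)"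
    proof (cases "\<forall>k\<in>K. Poly_Mapping.lookup e k \<ge> 1")
      case True
      then have "(\<Prod>k\<in>K. ?g ?n k (Poly_Mapping.lookup e k))
          = (\<Prod>k\<in>K. rat_of_nat (multichoose (c k * Poly_Mapping.lookup e k) ?n))"
        by (intro prod.cong) auto
      then show ?thesis using True by simp
    next
      case False
      then obtain k where "k \<in> K" "Poly_Mapping.lookup e k = 0"
        by (auto simp: not_le)
      then have "(\<Prod>k\<in>K. ?g ?n k (Poly_Mapping.lookup e k)) = 0"
        using assms(1) by (intro prod_zero bexI[of _ k]) simp_all
      with False show ?thesis by auto
    qed
    finally show "coef (power_sum t (\<lambda>d. ?a d * ?b d)) e
      = (if Poly_Mapping.keys e \<subseteq> insert t K \<and> (\<forall>k\<in>K. Poly_Mapping.lookup e k \<ge> 1)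
      then of_nat ((\<Prod>k\<in>K. multichoose (c k * Poly_Mapping.lookup e k) ?n)
        * (\<Prod>j\<in>J. multichoose (N j) ?n)) else 0)" .
  qed
  finally show ?thesis .
qed

section \<open>Monomial maps\<close>

text \<open>The additive extension of \<open>v \<mapsto> g v\<close>: the exponent of the image of the monomial with exponent \<open>u\<close>
  under the substitution of the monomial with exponent \<open>g v\<close> for each variable \<open>v\<close>.\<close>
definition exponent_map :: "('v \<Rightarrow> 'w \<Rightarrow>\<^sub>0 nat) \<Rightarrow> ('v \<Rightarrow>\<^sub>0 nat) \<Rightarrow> 'w \<Rightarrow>\<^sub>0 nat" where
  "exponent_map g u = (\<Sum>v\<in>Poly_Mapping.keys u. \<Sum>_<Poly_Mapping.lookup u v. g v)"

lemma lookup_exponent_map: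
  assumes "finite A" "Poly_Mapping.keys u \<subseteq> A"
  shows "Poly_Mapping.lookup (exponent_map g u) y
    = (\<Sum>v\<in>A. Poly_Mapping.lookup u v * Poly_Mapping.lookup (g v) y)"
  unfolding exponent_map_def lookup_sum
  by (rule sum.mono_neutral_cong_left) (use assms in \<open>auto simp: in_keys_iff\<close>)

lemma exponent_map_add: "exponent_map g (u + w) = exponent_map g u + exponent_map g w"
proof (rule poly_mapping_eqI)
  fix y
  let ?A = "Poly_Mapping.keys u \<union> Poly_Mapping.keys w"
  show "Poly_Mapping.lookup (exponent_map g (u + w)) y
    = Poly_Mapping.lookup (exponent_map g u + exponent_map g w) y"
    by (simp add: lookup_add lookup_exponent_map[of ?A] keys_add_nat distrib_right sum.distrib)
qed

lemma exponent_map_0 [simp]: "exponent_map g 0 = 0"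
  by (simp add: exponent_map_def)

lemma exponent_map_single_1 [simp]: "exponent_map g (Poly_Mapping.single v 1) = g v"
  by (simp add: exponent_map_def)

lemma keys_exponent_map:
  assumes "\<And>v. v \<in> V \<Longrightarrow> Poly_Mapping.keys (g v) \<subseteq> W" "Poly_Mapping.keys u \<subseteq> V"
  shows "Poly_Mapping.keys (exponent_map g u) \<subseteq> W"
  using assms unfolding subset_iff
  by (auto simp: in_keys_iff lookup_exponent_map[of "Poly_Mapping.keys u"] subset_iff)

lemma sum_single_lookup: "(\<Sum>u\<in>Poly_Mapping.keys p. Poly_Mapping.single u (Poly_Mapping.lookup p u)) = p"
  by (rule poly_mapping_eqI) (auto simp: lookup_sum lookup_single when_def in_keys_iff)

lemma prod_single_1:
  "(\<Prod>i\<in>I. Poly_Mapping.single (g i) 1 :: ('w, 'k::comm_ring_1) mpoly) = Poly_Mapping.single (\<Sum>i\<in>I. g i) 1"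
  by (induction I rule: infinite_finite_induct) (simp_all add: mult_single)

lemma msubst_monomials:
  "msubst (\<lambda>v. Poly_Mapping.single (g v) 1) p
    = (\<Sum>u\<in>Poly_Mapping.keys p. Poly_Mapping.single (exponent_map g u) (Poly_Mapping.lookup p u))"
  for p :: "('v, 'k::comm_ring_1) mpoly"
proof -
  have power: "Poly_Mapping.single a (1::'k) ^ n = Poly_Mapping.single (\<Sum>_<n. a) 1" for a :: "'b \<Rightarrow>\<^sub>0 nat" and n
    using prod_single_1[of "\<lambda>_. a" "{..<n}"] by simp
  show ?thesis
    unfolding msubst_def power prod_single_1 mconst_def mult_single exponent_map_def by simp
qed

abbreviation monomial_subst :: "('v \<Rightarrow> 'w \<Rightarrow>\<^sub>0 nat) \<Rightarrow> ('v, 'k::comm_ring_1) mpoly \<Rightarrow> ('w, 'k) mpoly" where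
  "monomial_subst g \<equiv> msubst (\<lambda>v. Poly_Mapping.single (g v) 1)"

lemma monomial_subst_superset:
  assumes "finite U" "Poly_Mapping.keys p \<subseteq> U"
  shows "monomial_subst g p = (\<Sum>u\<in>U. Poly_Mapping.single (exponent_map g u) (Poly_Mapping.lookup p u))"
  unfolding msubst_monomials
  by (rule sum.mono_neutral_left) (use assms in \<open>auto simp: in_keys_iff\<close>)

lemma monomial_subst_add: "monomial_subst g (p + q) = monomial_subst g p + monomial_subst g q"
  using keys_add[of p q]
  by (simp add: monomial_subst_superset[of "Poly_Mapping.keys p \<union> Poly_Mapping.keys q"] lookup_add
      single_add sum.distrib)

lemma monomial_subst_0 [simp]: "monomial_subst g 0 = 0"
  by (simp add: msubst_def)

lemma monomial_subst_sum: "monomial_subst g (\<Sum>i\<in>I. p i) = (\<Sum>i\<in>I. monomial_subst g (p i))"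
  by (induction I rule: infinite_finite_induct) (simp_all add: monomial_subst_add)

lemma monomial_subst_single:
  "monomial_subst g (Poly_Mapping.single u a) = Poly_Mapping.single (exponent_map g u) a"
  by (simp add: monomial_subst_superset[of "{u}"])

lemma monomial_subst_mult: "monomial_subst g (p * q) = monomial_subst g p * monomial_subst g q"
proof -
  have "monomial_subst g (p * q) = monomial_subst g (
      (\<Sum>u\<in>Poly_Mapping.keys p. Poly_Mapping.single u (Poly_Mapping.lookup p u))
      * (\<Sum>w\<in>Poly_Mapping.keys q. Poly_Mapping.single w (Poly_Mapping.lookup q w)))"
    by (simp only: sum_single_lookup)
  also have "\<dots> = monomial_subst g p * monomial_subst g q"
    by (simp add: sum_product monomial_subst_sum mult_single monomial_subst_single exponent_map_add
        monomial_subst_superset[of "Poly_Mapping.keys p" p] monomial_subst_superset[of "Poly_Mapping.keys q" q])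
  finally show ?thesis .
qed

lemma monomial_subst_mpolys:
  assumes "\<And>v. v \<in> V \<Longrightarrow> Poly_Mapping.keys (g v) \<subseteq> W" "p \<in> mpolys V"
  shows "monomial_subst g p \<in> mpolys W"
proof -
  have "(\<Sum>u\<in>U. Poly_Mapping.single (exponent_map g u) (Poly_Mapping.lookup p u)) \<in> mpolys W"
    if "U \<subseteq> Poly_Mapping.keys p" for U
    using that
  proof (induction U rule: infinite_finite_induct)
    case (insert u U)
    then have "Poly_Mapping.keys (exponent_map g u) \<subseteq> W"
      using assms(2) by (intro keys_exponent_map[OF assms(1)]) (auto simp: mpolys_def)
    then have "Poly_Mapping.single (exponent_map g u) (Poly_Mapping.lookup p u) \<in> mpolys W"
      by (auto simp: mpolys_def)
    with insert show ?case by (auto intro: mpolys_add)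
  qed auto
  then show ?thesis unfolding msubst_monomials by blast
qed

section \<open>The polynomial ring and the kernel of a monomial map\<close>

lemma carrier_mpoly_ring [simp]: "carrier (mpoly_ring V) = mpolys V"
  and mult_mpoly_ring [simp]: "monoid.mult (mpoly_ring V) = (*)"
  and one_mpoly_ring [simp]: "monoid.one (mpoly_ring V) = 1"
  and zero_mpoly_ring [simp]: "ring.zero (mpoly_ring V) = 0"
  and add_mpoly_ring [simp]: "ring.add (mpoly_ring V) = (+)"
  by (simp_all add: mpoly_ring_def)

lemma cring_mpoly_ring: "cring (mpoly_ring V :: ('v, 'k::comm_ring_1) mpoly ring)"
proof (rule cringI)
  show "abelian_group (mpoly_ring V :: ('v, 'k) mpoly ring)"
  proof (rule abelian_groupI)
    fix p :: "('v, 'k) mpoly" assume "p \<in> carrier (mpoly_ring V)"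
    then show "\<exists>q\<in>carrier (mpoly_ring V). q \<oplus>\<^bsub>mpoly_ring V\<^esub> p = \<zero>\<^bsub>mpoly_ring V\<^esub>"
      by (intro bexI[of _ "- p"]) (auto intro: mpolys_uminus)
  qed (auto simp: mpolys_add ac_simps)
  show "comm_monoid (mpoly_ring V :: ('v, 'k) mpoly ring)"
    by (rule comm_monoidI) (auto simp: mpolys_mult ac_simps)
qed (auto simp: distrib_right)

lemma ring_hom_monomial_subst:
  assumes "\<And>v. v \<in> V \<Longrightarrow> Poly_Mapping.keys (g v) \<subseteq> W"
  shows "ring_hom_ring (mpoly_ring V) (mpoly_ring W)
    (monomial_subst g :: ('v, 'k::comm_ring_1) mpoly \<Rightarrow> ('w, 'k) mpoly)"
proof (rule ring_hom_ringI2)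
  have "monomial_subst g (1 :: ('v, 'k) mpoly) = 1"
    using monomial_subst_single[of g 0 "1 :: 'k"] by simp
  then show "(monomial_subst g :: ('v, 'k) mpoly \<Rightarrow> _) \<in> ring_hom (mpoly_ring V) (mpoly_ring W)"
    using assms by (intro ring_hom_memI)
      (auto simp: monomial_subst_add monomial_subst_mult intro: monomial_subst_mpolys)
qed (simp_all add: cring.axioms(1) cring_mpoly_ring)

lemma subfield_constants: "subfield (range mconst) (mpoly_ring V :: ('v, 'k::field) mpoly ring)"
proof -
  interpret cring "mpoly_ring V :: ('v, 'k) mpoly ring" by (rule cring_mpoly_ring)
  show ?thesis
  proof (rule subfield_iff(1))
    let ?K = "mpoly_ring V\<lparr>carrier := range mconst\<rparr> :: ('v, 'k) mpoly ring"
    have mult: "mconst a * mconst b = (mconst (a * b) :: ('v, 'k) mpoly)" for a b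
      by (simp add: mconst_def mult_single)
    have add: "mconst a + mconst b = (mconst (a + b) :: ('v, 'k) mpoly)" for a b
      by (simp add: mconst_def single_add)
    have neg: "mconst (- a) + mconst a = (0 :: ('v, 'k) mpoly)" for a
      by (simp add: add) (simp add: mconst_def)
    have zero: "(0 :: ('v, 'k) mpoly) \<in> range mconst"
      by (rule range_eqI[of _ _ 0]) (simp add: mconst_def)
    have one: "(1 :: ('v, 'k) mpoly) \<in> range mconst"
      by (rule range_eqI[of _ _ 1]) (simp add: mconst_def)
    have "cring ?K"
    proof (rule cringI)
      show "abelian_group ?K"
      proof (rule abelian_groupI)
        fix p assume "p \<in> carrier ?K"
        then show "\<exists>q\<in>carrier ?K. q \<oplus>\<^bsub>?K\<^esub> p = \<zero>\<^bsub>?K\<^esub>"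
          using neg by auto
      qed (auto simp: add zero ac_simps)
      show "comm_monoid ?K"
        by (rule comm_monoidI) (auto simp: mult one ac_simps)
    qed (auto simp: distrib_right)
    then show "field ?K"
    proof (rule cring.cring_fieldI2)
      fix p assume "p \<in> carrier ?K" "p \<noteq> \<zero>\<^bsub>?K\<^esub>"
      then obtain a where a: "p = mconst a" by auto
      with \<open>p \<noteq> \<zero>\<^bsub>?K\<^esub>\<close> have "a \<noteq> 0" by (auto simp: mconst_def)
      with a show "\<exists>b\<in>carrier ?K. p \<otimes>\<^bsub>?K\<^esub> b = \<one>\<^bsub>?K\<^esub>"
        by (intro bexI[of _ "mconst (1 / a)"]) (auto simp: mult mconst_one)
    qed simp
    show "range mconst \<subseteq> carrier (mpoly_ring V :: ('v, 'k) mpoly ring)" by auto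
  qed
qed

text \<open>A coset of the kernel is determined by its image, and monomials are mapped to monomials. Hence
  the cosets of monomials with pairwise distinct images are linearly independent, and monomials with the
  same image have the same coset: choosing one monomial for each image yields a basis of the component
  of degree \<open>d\<close>. The proof adds the basis elements one at a time, following the inductive definition of
  dimension by line extensions.\<close>
lemma dim_quotient_by_monomial_kernel:
  fixes g :: "'v \<Rightarrow> 'w \<Rightarrow>\<^sub>0 nat"
  assumes W: "\<And>v. v \<in> V \<Longrightarrow> Poly_Mapping.keys (g v) \<subseteq> W"
    and I: "I = a_kernel (mpoly_ring V) (mpoly_ring W)
      (monomial_subst g :: ('v, 'k::field) mpoly \<Rightarrow> ('w, 'k) mpoly)"
    and Y: "Y = exponent_map g ` {u. Poly_Mapping.keys u \<subseteq> V \<and> mono_degree u = d}" "finite Y"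
  shows "ring.dim (mpoly_ring V Quot I) (quot_field V I) (quot_component V I d) = card Y"
proof -
  let ?R = "mpoly_ring V :: ('v, 'k) mpoly ring"
  let ?h = "monomial_subst g :: ('v, 'k) mpoly \<Rightarrow> ('w, 'k) mpoly"
  let ?Q = "?R Quot I"
  let ?c = "\<lambda>p. I +>\<^bsub>?R\<^esub> p"
  interpret h: ring_hom_ring ?R "mpoly_ring W" ?h
    by (rule ring_hom_monomial_subst[OF W])
  interpret I: ideal I ?R
    unfolding I by (rule h.kernel_is_ideal)
  interpret Q: ring ?Q by (rule I.quotient_is_ring)
  interpret c: ring_hom_ring ?R ?Q ?c by (rule I.rcos_ring_hom_ring)
  have coset: "?c p = {x \<in> mpolys V. ?h x = ?h p}" if "p \<in> mpolys V" for p
    unfolding I using h.rcos_eq_homeq[of p] that by simp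
  have coset_eq: "?c p = ?c p' \<longleftrightarrow> ?h p = ?h p'" if "p \<in> mpolys V" "p' \<in> mpolys V" for p p'
    using that by (auto simp: coset)
  have K: "quot_field V I = ?c ` range mconst"
    by (auto simp: quot_field_def)
  have subfield: "subfield (quot_field V I) ?Q"
    unfolding K
  proof (rule c.img_is_subfield(2)[OF subfield_constants])
    have "?h 1 \<noteq> ?h 0"
      using h.hom_one by simp
    then have "?c 1 \<noteq> ?c 0"
      by (subst coset_eq) auto
    moreover have "?c 0 = \<zero>\<^bsub>?Q\<^esub>" using c.hom_zero by simp
    moreover have "?c 1 = \<one>\<^bsub>?Q\<^esub>" using c.hom_one by simp
    ultimately show "\<one>\<^bsub>?Q\<^esub> \<noteq> \<zero>\<^bsub>?Q\<^esub>" by metis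
  qed
  define E where "E U = ?c ` {p. Poly_Mapping.keys p \<subseteq> U}" for U
  have in_V: "p \<in> mpolys V" if "Poly_Mapping.keys p \<subseteq> U" "\<And>u. u \<in> U \<Longrightarrow> Poly_Mapping.keys u \<subseteq> V" for p :: "('v, 'k) mpoly" and U
    using that by (auto simp: mpolys_def)
  have dimension: "Q.dimension (length us) (quot_field V I) (E (set us))"
    if "distinct (map (exponent_map g) us)" "\<And>u. u \<in> set us \<Longrightarrow> Poly_Mapping.keys u \<subseteq> V" for us
    using that
  proof (induction us)
    case Nil
    have "E (set []) = {\<zero>\<^bsub>?Q\<^esub>}"
      using c.hom_zero by (simp add: E_def)
    then show ?case by simp
  next
    case (Cons u us)
    let ?u = "Poly_Mapping.single u 1 :: ('v, 'k) mpoly"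
    have u: "?u \<in> mpolys V"
      using Cons.prems(2)[of u] by (auto simp: mpolys_def)
    have "?c ?u \<notin> E (set us)"
    proof
      assume "?c ?u \<in> E (set us)"
      then obtain p where p: "Poly_Mapping.keys p \<subseteq> set us" "?c ?u = ?c p"
        by (auto simp: E_def)
      then have "?h ?u = ?h p"
        using u in_V[of p "set us"] Cons.prems(2) by (subst (asm) coset_eq) auto
      then have "Poly_Mapping.lookup (?h p) (exponent_map g u) = 1"
        by (simp add: monomial_subst_single flip: \<open>?h ?u = ?h p\<close>)
      moreover have "Poly_Mapping.lookup (?h p) (exponent_map g u) = 0"
        unfolding msubst_monomials lookup_sum
      proof (intro sum.neutral ballI)
        fix w assume "w \<in> Poly_Mapping.keys p"
        then have "exponent_map g w \<noteq> exponent_map g u"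
          using p(1) Cons.prems(1) by (metis distinct.simps(2) imageI list.set_map list.simps(9) subsetD)
        then show "Poly_Mapping.lookup (Poly_Mapping.single (exponent_map g w) (Poly_Mapping.lookup p w))
            (exponent_map g u) = 0"
          by (simp add: lookup_single when_def)
      qed
      ultimately show False by simp
    qed
    moreover have "E (set (u # us)) = Q.line_extension (quot_field V I) (?c ?u) (E (set us))"
    proof (intro equalityI subsetI)
      fix x assume "x \<in> E (set (u # us))"
      then obtain p where p: "Poly_Mapping.keys p \<subseteq> set (u # us)" "x = ?c p"
        by (auto simp: E_def)
      let ?a = "Poly_Mapping.lookup p u"
      let ?p = "p - Poly_Mapping.single u ?a"
      have keys: "Poly_Mapping.keys ?p \<subseteq> set us"
        using p(1) by (auto simp: in_keys_iff lookup_minus lookup_single when_def split: if_splits)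
      have "mconst ?a * ?u + ?p = p"
        by (simp add: mconst_def mult_single)
      then have "x = ?c (mconst ?a * ?u + ?p)" using p by simp
      also have "\<dots> = ?c (mconst ?a) \<otimes>\<^bsub>?Q\<^esub> ?c ?u \<oplus>\<^bsub>?Q\<^esub> ?c ?p"
        using u in_V[OF keys] Cons.prems(2) c.hom_add[of "mconst ?a * ?u" ?p] c.hom_mult[of "mconst ?a" ?u]
        by (simp add: mpolys_mult)
      finally show "x \<in> Q.line_extension (quot_field V I) (?c ?u) (E (set us))"
        unfolding Q.line_extension_mem_iff K E_def using keys by blast
    next
      fix x assume "x \<in> Q.line_extension (quot_field V I) (?c ?u) (E (set us))"
      then obtain a p where p: "Poly_Mapping.keys p \<subseteq> set us"
          "x = ?c (mconst a) \<otimes>\<^bsub>?Q\<^esub> ?c ?u \<oplus>\<^bsub>?Q\<^esub> ?c p"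
        unfolding Q.line_extension_mem_iff K E_def by blast
      have "x = ?c (mconst a * ?u + p)"
        using p u in_V[OF p(1)] Cons.prems(2) c.hom_add[of "mconst a * ?u" p] c.hom_mult[of "mconst a" ?u]
        by (simp add: mpolys_mult)
      moreover have "Poly_Mapping.keys (mconst a * ?u + p) \<subseteq> set (u # us)"
        using p(1) keys_add[of "mconst a * ?u" p] by (auto simp: mconst_def mult_single split: if_splits)
      ultimately show "x \<in> E (set (u # us))" by (auto simp: E_def)
    qed
    moreover have "?c ?u \<in> carrier ?Q"
      using c.hom_closed[of ?u] u by simp
    ultimately show ?case
      using Cons by (auto intro!: Q.Suc_dim)
  qed
  let ?M = "{u. Poly_Mapping.keys u \<subseteq> V \<and> mono_degree u = d}"
  obtain ys where ys: "set ys = Y" "distinct ys"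
    using finite_distinct_list[OF Y(2)] by blast
  \<comment> \<open>A basis: one monomial \<open>r y\<close> for every image \<open>y\<close>.\<close>
  define r where "r = inv_into ?M (exponent_map g)"
  have r: "r y \<in> ?M" "exponent_map g (r y) = y" if "y \<in> Y" for y
    using that inv_into_into[of y "exponent_map g" ?M] f_inv_into_f[of y "exponent_map g" ?M]
    unfolding r_def Y(1) by blast+
  let ?us = "map r ys"
  have "map (exponent_map g) ?us = ys"
    using r ys by (auto intro!: map_idI simp: comp_def)
  then have dim: "Q.dimension (length ?us) (quot_field V I) (E (set ?us))"
    by (intro dimension) (use r ys in auto)
  have "quot_component V I d = E ?M"
    unfolding quot_component_def E_def homogeneous_part_def mpolys_def by (rule arg_cong[of _ _ "image ?c"]) auto
  also have "E ?M = E (set ?us)"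
  proof
    have "set ?us \<subseteq> ?M" using r(1) ys by auto
    then show "E (set ?us) \<subseteq> E ?M" unfolding E_def by blast
    show "E ?M \<subseteq> E (set ?us)"
    proof
      fix x assume "x \<in> E ?M"
      then obtain p where p: "Poly_Mapping.keys p \<subseteq> ?M" "x = ?c p" by (auto simp: E_def)
      let ?p = "\<Sum>u\<in>Poly_Mapping.keys p. Poly_Mapping.single (r (exponent_map g u)) (Poly_Mapping.lookup p u)"
      have "exponent_map g u \<in> Y" if "u \<in> Poly_Mapping.keys p" for u
        using that p Y(1) by auto
      note in_Y = this
      then have hp: "?h ?p = ?h p"
        by (simp add: monomial_subst_sum monomial_subst_single r msubst_monomials[of g p])
      have keys: "Poly_Mapping.keys ?p \<subseteq> set ?us"
      proof
        fix w assume "w \<in> Poly_Mapping.keys ?p"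
        then have "w \<in> (\<Union>u\<in>Poly_Mapping.keys p. Poly_Mapping.keys
            (Poly_Mapping.single (r (exponent_map g u)) (Poly_Mapping.lookup p u)))"
          by (rule subsetD[OF keys_sum])
        then show "w \<in> set ?us"
          using in_Y ys(1) by (auto split: if_splits)
      qed
      have "p \<in> mpolys V" using in_V[OF p(1)] by blast
      moreover have "?p \<in> mpolys V" using \<open>set ?us \<subseteq> ?M\<close> by (intro in_V[OF keys]) blast
      ultimately have "x = ?c ?p" unfolding p(2) by (rule coset_eq[THEN iffD2]) (rule hp[symmetric])
      then show "x \<in> E (set ?us)" using keys by (auto simp: E_def)
    qed
  qed
  finally have "quot_component V I d = E (set ?us)" .
  then have "Q.dim (quot_field V I) (quot_component V I d) = length ?us"
    using Q.dimI[OF subfield dim] by (simp add: over_def)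
  also have "\<dots> = card Y" using ys distinct_card by fastforce
  finally show ?thesis .
qed

section \<open>Counting exponent vectors\<close>

lemma mono_degree_superset:
  assumes "finite A" "Poly_Mapping.keys u \<subseteq> A"
  shows "mono_degree u = (\<Sum>v\<in>A. Poly_Mapping.lookup u v)"
  unfolding mono_degree_def
  by (rule sum.mono_neutral_left) (use assms in \<open>auto simp: in_keys_iff\<close>)

lemma mono_degree_add: "mono_degree (u + w) = mono_degree u + mono_degree w"
  by (simp add: mono_degree_superset[of "Poly_Mapping.keys u \<union> Poly_Mapping.keys w"] keys_add_nat
      lookup_add sum.distrib)

lemma mono_degree_0 [simp]: "mono_degree 0 = 0"
  by (simp add: mono_degree_def)

lemma mono_degree_single [simp]: "mono_degree (Poly_Mapping.single v n) = n"
  by (simp add: mono_degree_def)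

lemma mono_degree_eq_0_iff: "mono_degree u = 0 \<longleftrightarrow> u = 0"
proof
  assume "mono_degree u = 0"
  then have "Poly_Mapping.lookup u v = 0" for v
    by (cases "v \<in> Poly_Mapping.keys u") (simp_all add: mono_degree_def in_keys_iff)
  then show "u = 0" by (intro poly_mapping_eqI) simp
qed simp

lemma single_add_diff:
  assumes "Poly_Mapping.lookup u a \<noteq> (0 :: nat)"
  shows "u - Poly_Mapping.single a 1 + Poly_Mapping.single a 1 = u"
  by (rule poly_mapping_eqI) (use assms in \<open>auto simp: lookup_add lookup_minus lookup_single when_def\<close>)

text \<open>Pascal's rule again: an exponent vector on \<open>insert a A\<close> either avoids \<open>a\<close> or arises from one of smaller
  degree by raising the exponent of \<open>a\<close>.\<close>
lemma card_exponents_of_degree: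
  assumes "finite A"
  shows "finite {u. Poly_Mapping.keys u \<subseteq> A \<and> mono_degree u = d}
    \<and> card {u. Poly_Mapping.keys u \<subseteq> A \<and> mono_degree u = d} = multichoose (card A) d"
  using assms
proof (induction A arbitrary: d rule: finite_induct)
  case empty
  have "{u :: 'a \<Rightarrow>\<^sub>0 nat. Poly_Mapping.keys u \<subseteq> {} \<and> mono_degree u = d} = (if d = 0 then {0} else {})"
    by (auto simp: mono_degree_def)
  then show ?case by (cases d) auto
next
  case (insert a A)
  let ?X = "\<lambda>A d. {u. Poly_Mapping.keys u \<subseteq> A \<and> mono_degree u = d}"
  show ?case
  proof (induction d)
    case 0
    have "?X (insert a A) 0 = {0}"
      by (auto simp: mono_degree_eq_0_iff)
    then show ?case by simp
  next
    case (Suc d)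
    let ?f = "\<lambda>u. u + Poly_Mapping.single a (1 :: nat)"
    have "?X (insert a A) (Suc d) = ?X A (Suc d) \<union> ?f ` ?X (insert a A) d"
    proof (intro equalityI subsetI)
      fix u assume u: "u \<in> ?X (insert a A) (Suc d)"
      show "u \<in> ?X A (Suc d) \<union> ?f ` ?X (insert a A) d"
      proof (cases "Poly_Mapping.lookup u a = 0")
        case True
        then show ?thesis using u by (auto simp: in_keys_iff)
      next
        case False
        let ?w = "u - Poly_Mapping.single a (1 :: nat)"
        have w: "?f ?w = u" using False by (rule single_add_diff)
        then have "mono_degree ?w = d" "Poly_Mapping.keys ?w \<subseteq> insert a A"
          using u mono_degree_add[of ?w "Poly_Mapping.single a 1"] keys_add_nat[of ?w "Poly_Mapping.single a 1"]
          by auto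
        then show ?thesis using w by (intro UnI2 image_eqI[of _ _ ?w]) auto
      qed
    qed (auto simp: mono_degree_add keys_add_nat)
    moreover have "?X A (Suc d) \<inter> ?f ` ?X (insert a A) d = {}"
      using insert.hyps by (auto simp: keys_add_nat)
    moreover have "inj_on ?f (?X (insert a A) d)"
      by (auto simp: inj_on_def)
    ultimately show ?case
      using insert.IH[of "Suc d"] insert.hyps Suc
      by (simp add: card_Un_disjoint card_image multichoose_Suc_Suc)
  qed
qed

definition restrict_keys :: "'v set \<Rightarrow> ('v \<Rightarrow>\<^sub>0 nat) \<Rightarrow> 'v \<Rightarrow>\<^sub>0 nat" where
  "restrict_keys A u = (\<Sum>v\<in>Poly_Mapping.keys u \<inter> A. Poly_Mapping.single v (Poly_Mapping.lookup u v))"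

lemma lookup_restrict_keys:
  "Poly_Mapping.lookup (restrict_keys A u) v = (if v \<in> A then Poly_Mapping.lookup u v else 0)"
  by (auto simp: restrict_keys_def lookup_sum lookup_single when_def in_keys_iff)

text \<open>An exponent vector on the disjoint union of the \<open>B j\<close> is the sum of its parts on the \<open>B j\<close>, which can be
  chosen independently.\<close>
lemma card_exponents_of_multidegree:
  assumes "finite Q" "\<And>j. j \<in> Q \<Longrightarrow> finite (B j)"
  shows "finite {y. Poly_Mapping.keys y \<subseteq> (SIGMA j:Q. B j) \<and>
      (\<forall>j\<in>Q. (\<Sum>k\<in>B j. Poly_Mapping.lookup y (j, k)) = d)} \<and>
    card {y. Poly_Mapping.keys y \<subseteq> (SIGMA j:Q. B j) \<and>
      (\<forall>j\<in>Q. (\<Sum>k\<in>B j. Poly_Mapping.lookup y (j, k)) = d)} = (\<Prod>j\<in>Q. multichoose (card (B j)) d)"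
  using assms
proof (induction Q rule: finite_induct)
  case empty
  have "{y :: 'a \<times> 'b \<Rightarrow>\<^sub>0 nat. Poly_Mapping.keys y \<subseteq> (SIGMA j:{}. B j) \<and>
      (\<forall>j\<in>{}. (\<Sum>k\<in>B j. Poly_Mapping.lookup y (j, k)) = d)} = {0}"
    by auto
  then show ?case by simp
next
  case (insert i Q)
  let ?Y = "\<lambda>Q. {y. Poly_Mapping.keys y \<subseteq> (SIGMA j:Q. B j) \<and>
      (\<forall>j\<in>Q. (\<Sum>k\<in>B j. Poly_Mapping.lookup y (j, k)) = d)}"
  let ?Z = "{z. Poly_Mapping.keys z \<subseteq> {i} \<times> B i \<and> mono_degree z = d}"
  have degree: "mono_degree z = (\<Sum>k\<in>B i. Poly_Mapping.lookup z (i, k))"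
    if "Poly_Mapping.keys z \<subseteq> {i} \<times> B i" for z
  proof -
    have "mono_degree z = (\<Sum>v\<in>{i} \<times> B i. Poly_Mapping.lookup z v)"
      using that insert.prems by (intro mono_degree_superset) auto
    also have "{i} \<times> B i = Pair i ` B i" by auto
    finally show ?thesis by (simp add: sum.reindex inj_on_def)
  qed
  have 1: "Poly_Mapping.lookup y (i, k) = 0" if "y \<in> ?Y Q" for y k
    using that insert.hyps by (auto simp: in_keys_iff)
  have 2: "Poly_Mapping.lookup z (j, k) = 0" if "z \<in> ?Z" "j \<in> Q" for z j k
    using that insert.hyps by (auto simp: in_keys_iff)
  have 3: "Poly_Mapping.lookup z (j, k) = 0" if "z \<in> ?Z" "j \<noteq> i" for z j k
    using that by (auto simp: in_keys_iff)
  have inj: "inj_on (\<lambda>(y, z). y + z) (?Y Q \<times> ?Z)"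
  proof (rule inj_onI)
    fix p p' assume p: "p \<in> ?Y Q \<times> ?Z" "p' \<in> ?Y Q \<times> ?Z"
      and sum: "(case p of (y, z) \<Rightarrow> y + z) = (case p' of (y, z) \<Rightarrow> y + z)"
    obtain y z y' z' where pp: "p = (y, z)" "p' = (y', z')" by (cases p; cases p')
    have yz: "y \<in> ?Y Q" "z \<in> ?Z" "y' \<in> ?Y Q" "z' \<in> ?Z"
      using p by (simp_all only: pp mem_Sigma_iff)
    have eq: "y + z = y' + z'"
      using sum by (simp only: pp prod.case)
    have "Poly_Mapping.lookup z x = Poly_Mapping.lookup z' x" for x
    proof (cases x)
      case (Pair j k)
      have "Poly_Mapping.lookup y x + Poly_Mapping.lookup z x = Poly_Mapping.lookup y' x + Poly_Mapping.lookup z' x"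
        by (metis eq lookup_add)
      then show ?thesis
        using 1[OF yz(1), of k] 1[OF yz(3), of k] 3[OF yz(2), of j k] 3[OF yz(4), of j k] Pair
        by (cases "j = i") auto
    qed
    then have "z = z'" by (rule poly_mapping_eqI)
    then show "p = p'" using eq pp by simp
  qed
  have "?Y (insert i Q) = (\<lambda>(y, z). y + z) ` (?Y Q \<times> ?Z)"
  proof (intro equalityI subsetI)
    fix y assume y: "y \<in> ?Y (insert i Q)"
    let ?a = "restrict_keys (Q \<times> UNIV) y" and ?b = "restrict_keys ({i} \<times> UNIV) y"
    have "y = ?a + ?b"
    proof (rule poly_mapping_eqI)
      fix x show "Poly_Mapping.lookup y x = Poly_Mapping.lookup (?a + ?b) x"
        using y insert.hyps by (cases x) (auto simp: lookup_add lookup_restrict_keys in_keys_iff subset_iff)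
    qed
    moreover have "?a \<in> ?Y Q"
      using y by (auto simp: lookup_restrict_keys in_keys_iff subset_iff split: if_splits)
    moreover have "?b \<in> ?Z"
    proof -
      have "Poly_Mapping.keys ?b \<subseteq> {i} \<times> B i"
        using y by (auto simp: lookup_restrict_keys in_keys_iff subset_iff split: if_splits)
      then show ?thesis
        using y degree[of ?b] by (simp add: lookup_restrict_keys)
    qed
    ultimately show "y \<in> (\<lambda>(y, z). y + z) ` (?Y Q \<times> ?Z)"
      by (intro image_eqI[of _ _ "(?a, ?b)"] SigmaI) (simp only: prod.case)
  next
    fix x assume "x \<in> (\<lambda>(y, z). y + z) ` (?Y Q \<times> ?Z)"
    then obtain y z where x: "x = y + z" and y: "y \<in> ?Y Q" and z: "z \<in> ?Z" by auto
    have "Poly_Mapping.keys x \<subseteq> (SIGMA j:insert i Q. B j)"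
      using x y z by (auto simp: keys_add_nat)
    moreover have "(\<Sum>k\<in>B j. Poly_Mapping.lookup x (j, k)) = d" if "j \<in> Q" for j
      using that 2[OF z that] y by (simp add: x lookup_add)
    moreover have "(\<Sum>k\<in>B i. Poly_Mapping.lookup x (i, k)) = d"
      using 1[OF y] z degree[of z] by (simp add: x lookup_add)
    ultimately show "x \<in> ?Y (insert i Q)" by auto
  qed
  moreover have "finite ?Z \<and> card ?Z = multichoose (card (B i)) d"
    using card_exponents_of_degree[of "{i} \<times> B i" d] insert.prems by simp
  ultimately show ?case
    using insert inj by (simp add: card_image card_cartesian_product)
qed

section \<open>Hierarchical models with disjoint facets\<close>

text \<open>The exponent of the image \<open>\<Prod>\<^sub>j y\<^sub>j\<^sub>,\<^sub>i\<^sub>F\<close> of the variable \<open>x\<^sub>i\<close>.\<close>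
definition model_exponent :: "nat \<Rightarrow> (nat \<Rightarrow> nat set) \<Rightarrow> (nat \<Rightarrow> nat) \<Rightarrow> nat \<times> (nat \<Rightarrow> nat) \<Rightarrow>\<^sub>0 nat" where
  "model_exponent q F i = (\<Sum>j\<in>{1..q}. Poly_Mapping.single (j, restrict i (F j)) 1)"

lemma model_map_eq: "model_map q F = monomial_subst (model_exponent q F)"
  by (simp add: model_map_def mvar_def prod_single_1 model_exponent_def)

lemma lookup_model_exponent:
  "Poly_Mapping.lookup (model_exponent q F i) (j, k) = (if j \<in> {1..q} \<and> k = restrict i (F j) then 1 else 0)"
proof -
  have "Poly_Mapping.lookup (model_exponent q F i) (j, k)
      = (\<Sum>l\<in>{1..q}. if l = j then (if k = restrict i (F j) then 1 else 0) else 0)"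
    unfolding model_exponent_def lookup_sum by (rule sum.cong) (auto simp: lookup_single when_def)
  then show ?thesis by (simp add: sum.delta)
qed

lemma finite_state_set: "finite A \<Longrightarrow> finite (state_set r A)"
  by (simp add: state_set_def finite_PiE)

lemma restrict_state_set: "i \<in> state_set r A \<Longrightarrow> B \<subseteq> A \<Longrightarrow> restrict i B \<in> state_set r B"
  by (auto simp: state_set_def)

lemma facet_subset: "facet_collection m q F \<Longrightarrow> j \<in> {1..q} \<Longrightarrow> F j \<subseteq> {1..m}"
  and facet_cover: "facet_collection m q F \<Longrightarrow> (\<Union>j\<in>{1..q}. F j) = {1..m}"
  by (simp_all add: facet_collection_def)

lemma facet_finite: "facet_collection m q F \<Longrightarrow> j \<in> {1..q} \<Longrightarrow> finite (F j)"
  by (rule finite_subset[OF facet_subset]) auto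

lemma keys_model_exponent:
  assumes "facet_collection m q F" "i \<in> model_vars m r"
  shows "Poly_Mapping.keys (model_exponent q F i) \<subseteq> param_vars q F r"
proof
  fix x assume "x \<in> Poly_Mapping.keys (model_exponent q F i)"
  then obtain j where j: "j \<in> {1..q}" "x = (j, restrict i (F j))"
    by (cases x) (auto simp: in_keys_iff lookup_model_exponent split: if_splits)
  have "restrict i (F j) \<in> state_set r (F j)"
    using assms(2) facet_subset[OF assms(1) j(1)] unfolding model_vars_def by (rule restrict_state_set)
  then show "x \<in> param_vars q F r" using j by (simp add: param_vars_def)
qed

lemma facet_disjoint:
  assumes "facet_collection m q F" "\<forall>i \<in> {1..q}. \<forall>j \<in> {1..q}. F i \<noteq> F j \<longrightarrow> F i \<inter> F j = {}"
    "i \<in> {1..q}" "j \<in> {1..q}" "i \<noteq> j"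
  shows "F i \<inter> F j = {}"
proof -
  have "\<not> F j \<subseteq> F i" using assms unfolding facet_collection_def by blast
  then show ?thesis using assms by blast
qed

text \<open>Here the two halves of the partition property enter: the facets are disjoint, so states on them never
  conflict, and they cover the vertices, so the states determine a full index.\<close>
lemma glue_states:
  assumes F: "facet_collection m q F"
    and disj: "\<And>i j. i \<in> {1..q} \<Longrightarrow> j \<in> {1..q} \<Longrightarrow> i \<noteq> j \<Longrightarrow> F i \<inter> F j = {}"
    and k: "\<And>j. j \<in> {1..q} \<Longrightarrow> k j \<in> state_set r (F j)"
  obtains i where "i \<in> model_vars m r" "\<And>j. j \<in> {1..q} \<Longrightarrow> restrict i (F j) = k j"
proof -
  have "\<exists>j. j \<in> {1..q} \<and> x \<in> F j" if "x \<in> {1..m}" for x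
    using facet_cover[OF F] that by blast
  then obtain f where f: "\<And>x. x \<in> {1..m} \<Longrightarrow> f x \<in> {1..q} \<and> x \<in> F (f x)" by metis
  have f_eq: "f x = j" if "j \<in> {1..q}" "x \<in> F j" for j x
  proof -
    have "x \<in> {1..m}" using facet_subset[OF F that(1)] that(2) by blast
    then show ?thesis using f[of x] disj[of "f x" j] that by blast
  qed
  let ?i = "\<lambda>x\<in>{1..m}. k (f x) x"
  show thesis
  proof (rule that[of ?i])
    show "?i \<in> model_vars m r"
      unfolding model_vars_def state_set_def
    proof (rule restrict_PiE_iff[THEN iffD2], rule ballI)
      fix x assume "x \<in> {1..m}"
      then show "k (f x) x \<in> {1..r x}"
        using f[of x] k[of "f x"] unfolding state_set_def by blast
    qed
    fix j assume j: "j \<in> {1..q}"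
    show "restrict ?i (F j) = k j"
    proof (rule extensionalityI[of _ "F j"])
      show "restrict ?i (F j) \<in> extensional (F j)" by (rule restrict_extensional)
      show "k j \<in> extensional (F j)" using k[OF j] by (auto simp: state_set_def PiE_def)
      fix x assume x: "x \<in> F j"
      then have "x \<in> {1..m}" using facet_subset[OF F j] by blast
      then show "restrict ?i (F j) x = k j x"
        using x f_eq[OF j x] by simp
    qed
  qed
qed

text \<open>Each variable \<open>x\<^sub>i\<close> contributes 1 to the degree in every group \<open>y\<^sub>j\<close>, which gives one inclusion. Conversely,
  an exponent vector of degree \<open>d + 1\<close> in every group contains some variable \<open>y\<^sub>j\<^sub>,\<^sub>k\<close> for each \<open>j\<close>; gluing these
  \<open>k\<close> gives a variable \<open>x\<^sub>i\<close> whose image can be split off, and induction on \<open>d\<close> applies.\<close>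
lemma exponent_map_model_image:
  assumes F: "facet_collection m q F"
    and disj: "\<And>i j. i \<in> {1..q} \<Longrightarrow> j \<in> {1..q} \<Longrightarrow> i \<noteq> j \<Longrightarrow> F i \<inter> F j = {}"
  shows "exponent_map (model_exponent q F) ` {u. Poly_Mapping.keys u \<subseteq> model_vars m r \<and> mono_degree u = d}
    = {y. Poly_Mapping.keys y \<subseteq> param_vars q F r \<and>
        (\<forall>j\<in>{1..q}. (\<Sum>k\<in>state_set r (F j). Poly_Mapping.lookup y (j, k)) = d)}"
    (is "?e ` ?U d = ?Y d")
proof (intro equalityI subsetI)
  have fin: "finite (state_set r (F j))" if "j \<in> {1..q}" for j
    using facet_finite[OF F that] by (rule finite_state_set)
  have slice: "(\<Sum>k\<in>state_set r (F j). Poly_Mapping.lookup (model_exponent q F i) (j, k)) = 1"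
    if "i \<in> model_vars m r" "j \<in> {1..q}" for i j
  proof -
    have "restrict i (F j) \<in> state_set r (F j)"
      using that(1) facet_subset[OF F that(2)] unfolding model_vars_def by (rule restrict_state_set)
    then show ?thesis
      using that fin[of j] by (simp add: lookup_model_exponent)
  qed
  fix y
  {
    assume "y \<in> ?e ` ?U d"
    then obtain u where u: "y = ?e u" "Poly_Mapping.keys u \<subseteq> model_vars m r" "mono_degree u = d" by auto
    have "Poly_Mapping.keys y \<subseteq> param_vars q F r"
      unfolding u(1) using keys_model_exponent[OF F] u(2) by (rule keys_exponent_map)
    moreover have "(\<Sum>k\<in>state_set r (F j). Poly_Mapping.lookup y (j, k)) = d" if j: "j \<in> {1..q}" for j
    proof -
      have "(\<Sum>k\<in>state_set r (F j). Poly_Mapping.lookup y (j, k))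
          = (\<Sum>v\<in>Poly_Mapping.keys u. Poly_Mapping.lookup u v *
              (\<Sum>k\<in>state_set r (F j). Poly_Mapping.lookup (model_exponent q F v) (j, k)))"
        unfolding u(1) lookup_exponent_map[OF finite_keys order_refl] sum_distrib_left by (rule sum.swap)
      also have "\<dots> = (\<Sum>v\<in>Poly_Mapping.keys u. Poly_Mapping.lookup u v)"
        using slice[OF _ j] u(2) by (intro sum.cong) auto
      finally show ?thesis using u(3) by (simp add: mono_degree_def)
    qed
    ultimately show "y \<in> ?Y d" by blast
  }
  assume "y \<in> ?Y d"
  then show "y \<in> ?e ` ?U d"
  proof (induction d arbitrary: y)
    case 0
    have "Poly_Mapping.lookup y x = 0" for x
    proof (rule ccontr)
      assume "Poly_Mapping.lookup y x \<noteq> 0"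
      then obtain j k where "x = (j, k)" "j \<in> {1..q}" "k \<in> state_set r (F j)"
        using 0 by (cases x) (auto simp: param_vars_def in_keys_iff subset_iff)
      moreover have "\<forall>k\<in>state_set r (F j). Poly_Mapping.lookup y (j, k) = 0"
      proof -
        have "(\<Sum>k\<in>state_set r (F j). Poly_Mapping.lookup y (j, k)) = 0"
          using 0 \<open>j \<in> {1..q}\<close> by blast
        then show ?thesis using fin[OF \<open>j \<in> {1..q}\<close>] by (simp only: sum_eq_0_iff)
      qed
      ultimately show False using \<open>Poly_Mapping.lookup y x \<noteq> 0\<close> by simp
    qed
    then have "y = ?e 0" by (auto intro: poly_mapping_eqI)
    then show ?case by (intro image_eqI[of _ _ 0]) auto
  next
    case (Suc d)
    have "\<exists>k. k \<in> state_set r (F j) \<and> Poly_Mapping.lookup y (j, k) \<noteq> 0" if "j \<in> {1..q}" for j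
    proof (rule ccontr)
      assume "\<not> ?thesis"
      then have "(\<Sum>k\<in>state_set r (F j). Poly_Mapping.lookup y (j, k)) = 0" by (intro sum.neutral) auto
      then show False using Suc.prems that by auto
    qed
    then obtain k where k: "\<And>j. j \<in> {1..q} \<Longrightarrow> k j \<in> state_set r (F j)"
        "\<And>j. j \<in> {1..q} \<Longrightarrow> Poly_Mapping.lookup y (j, k j) \<noteq> 0"
      by metis
    obtain i where i: "i \<in> model_vars m r" "\<And>j. j \<in> {1..q} \<Longrightarrow> restrict i (F j) = k j"
      using glue_states[OF F disj k(1)] by blast
    let ?w = "y - model_exponent q F i"
    have y: "?w + model_exponent q F i = y"
    proof (rule poly_mapping_eqI)
      fix x :: "nat \<times> (nat \<Rightarrow> nat)"
      obtain j l where x: "x = (j, l)" by (cases x)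
      show "Poly_Mapping.lookup (?w + model_exponent q F i) x = Poly_Mapping.lookup y x"
        using k(2)[of j] i(2)[of j] by (auto simp: x lookup_add lookup_minus lookup_model_exponent)
    qed
    have "?w \<in> ?Y d"
    proof -
      have "Poly_Mapping.keys ?w \<subseteq> param_vars q F r"
        using Suc.prems keys_add_nat[of ?w "model_exponent q F i"] unfolding y by blast
      moreover have "(\<Sum>l\<in>state_set r (F j). Poly_Mapping.lookup ?w (j, l)) = d" if j: "j \<in> {1..q}" for j
      proof -
        have "Suc d = (\<Sum>l\<in>state_set r (F j). Poly_Mapping.lookup (?w + model_exponent q F i) (j, l))"
          using Suc.prems j unfolding y by auto
        also have "\<dots> = (\<Sum>l\<in>state_set r (F j). Poly_Mapping.lookup ?w (j, l)) + 1"
          using slice[OF i(1) j] by (simp only: lookup_add sum.distrib)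
        finally show ?thesis by simp
      qed
      ultimately show ?thesis by blast
    qed
    then obtain u where u: "?w = ?e u" "u \<in> ?U d"
      using Suc.IH by blast
    have "?e (u + Poly_Mapping.single i 1) = y"
      unfolding exponent_map_add exponent_map_single_1 using u(1) y by simp
    moreover have "u + Poly_Mapping.single i 1 \<in> ?U (Suc d)"
      using u(2) i(1) mono_degree_single[of i 1] by (auto simp: mono_degree_add keys_add_nat)
    ultimately show ?case by blast
  qed
qed

text \<open>The Hilbert function of a Segre product is the product of the Hilbert functions of its factors, here
  polynomial rings with one variable for each state of a facet.\<close>
lemma hilbert_function_disjoint_facets:
  assumes F: "facet_collection m q F"
    and disj: "\<And>i j. i \<in> {1..q} \<Longrightarrow> j \<in> {1..q} \<Longrightarrow> i \<noteq> j \<Longrightarrow> F i \<inter> F j = {}"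
  shows "fps_nth (hilbert_series (model_vars m r)
      (toric_ideal m q F r :: (nat \<Rightarrow> nat, 'k::field) mpoly set)) d
    = of_nat (\<Prod>j\<in>{1..q}. multichoose (\<Prod>v\<in>F j. r v) d)"
proof -
  let ?Y = "{y. Poly_Mapping.keys y \<subseteq> param_vars q F r \<and>
        (\<forall>j\<in>{1..q}. (\<Sum>k\<in>state_set r (F j). Poly_Mapping.lookup y (j, k)) = d)}"
  have fin: "finite (F j)" if "j \<in> {1..q}" for j
    using facet_finite[OF F that] .
  have Y: "finite ?Y \<and> card ?Y = (\<Prod>j\<in>{1..q}. multichoose (card (state_set r (F j))) d)"
    unfolding param_vars_def
    by (rule card_exponents_of_multidegree) (simp, rule finite_state_set[OF fin])
  have "card (state_set r (F j)) = (\<Prod>v\<in>F j. r v)" if "j \<in> {1..q}" for j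
    using fin[OF that] by (simp add: state_set_def card_PiE)
  then have "card ?Y = (\<Prod>j\<in>{1..q}. multichoose (\<Prod>v\<in>F j. r v) d)"
    using Y by simp
  moreover have "ring.dim (mpoly_ring (model_vars m r) Quot toric_ideal m q F r)
      (quot_field (model_vars m r) (toric_ideal m q F r))
      (quot_component (model_vars m r) (toric_ideal m q F r :: (nat \<Rightarrow> nat, 'k) mpoly set) d) = card ?Y"
  proof (rule dim_quotient_by_monomial_kernel[OF keys_model_exponent[OF F]])
    show "toric_ideal m q F r = a_kernel (mpoly_ring (model_vars m r)) (mpoly_ring (param_vars q F r))
        (monomial_subst (model_exponent q F) :: (_, 'k) mpoly \<Rightarrow> _)"
      by (simp only: toric_ideal_def model_map_eq)
    show "?Y = exponent_map (model_exponent q F)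
        ` {u. Poly_Mapping.keys u \<subseteq> model_vars m r \<and> mono_degree u = d}"
      by (rule exponent_map_model_image[OF F disj, symmetric])
    show "finite ?Y" using Y by (rule conjunct1)
  qed
  ultimately show ?thesis
    unfolding hilbert_series_def by simp
qed

section \<open>The equivariant Hilbert series\<close>

lemma bij_betw_rank:
  fixes T :: "nat set"
  assumes "finite T"
  shows "bij_betw (\<lambda>v. card {u \<in> T. u \<le> v}) T {1..card T}"
proof -
  let ?f = "\<lambda>v. card {u \<in> T. u \<le> v}"
  have less: "?f v < ?f w" if "w \<in> T" "v < w" for v w
  proof (rule psubset_card_mono)
    have "w \<in> {u \<in> T. u \<le> w} - {u \<in> T. u \<le> v}" using that by simp
    moreover have "{u \<in> T. u \<le> v} \<subseteq> {u \<in> T. u \<le> w}" using that by auto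
    ultimately show "{u \<in> T. u \<le> v} \<subset> {u \<in> T. u \<le> w}" by blast
  qed (use assms in simp)
  have inj: "inj_on ?f T"
  proof (rule inj_onI)
    fix v w assume "v \<in> T" "w \<in> T" "?f v = ?f w"
    then show "v = w" using less[of v w] less[of w v] by (cases v w rule: linorder_cases) auto
  qed
  have "?f v \<in> {1..card T}" if "v \<in> T" for v
  proof -
    have "v \<in> {u \<in> T. u \<le> v}" using that by simp
    then have "?f v > 0" using assms by (auto simp only: card_gt_0_iff)
    moreover have "?f v \<le> card T" using assms by (intro card_mono) auto
    ultimately show ?thesis by simp
  qed
  then have "?f ` T \<subseteq> {1..card T}" by blast
  then have "?f ` T = {1..card T}"
    using card_image[OF inj] by (intro card_subset_eq) auto
  with inj show ?thesis by (simp add: bij_betw_def)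
qed

theorem theorem3p5:
  fixes m q :: nat and F :: "nat \<Rightarrow> nat set" and T :: "nat set" and c :: "nat \<Rightarrow> nat"
  assumes "m \<ge> 1"
    and "facet_collection m q F"
    and "T \<subseteq> {1..m}" and "T \<noteq> {}"
    and "\<forall>k \<in> {1..m - card T}. c k \<ge> 1"
    and "\<forall>i \<in> {1..q}. \<forall>j \<in> {1..q}. F i \<noteq> F j \<longrightarrow> F i \<inter> F j = {}"
    and "\<forall>j \<in> {1..q}. card (F j \<inter> T) \<le> 1"
  shows "rational_mseries {0..card T} (equiv_hilbert_series TYPE('k::field) m q F T c)"
proof -
  note F = assms(2)
  have disj: "F i \<inter> F j = {}" if "i \<in> {1..q}" "j \<in> {1..q}" "i \<noteq> j" for i j
    using facet_disjoint[OF F assms(6) that] .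
  let ?K = "{1..card T}"
  let ?rank = "\<lambda>v. card {u \<in> T. u \<le> v}"
  let ?T = "{j \<in> {1..q}. F j \<inter> T \<noteq> {}}"
  define b where "b j = (\<Prod>v\<in>F j - T. c (card {u \<in> {1..m} - T. u \<le> v}))" for j
  \<comment> \<open>The rank is the index of the variable \<open>s\<^sub>k\<close> that belongs to a vertex of \<open>T\<close>.\<close>
  have rank: "bij_betw ?rank T ?K"
    using assms(3) by (intro bij_betw_rank) (auto intro: finite_subset)
  have "\<exists>v. F j \<inter> T = {v}" if "j \<in> ?T" for j
  proof -
    have "finite (F j \<inter> T)" using facet_finite[OF F, of j] that by simp
    then have "card (F j \<inter> T) \<noteq> 0" using that by (simp only: card_0_eq) simp
    moreover have "card (F j \<inter> T) \<le> 1" using assms(7) that by blast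
    ultimately have "card (F j \<inter> T) = 1" by linarith
    then show ?thesis by (rule card_1_singletonE) blast
  qed
  then obtain v where v: "\<And>j. j \<in> ?T \<Longrightarrow> F j \<inter> T = {v j}"
    by metis
  \<comment> \<open>Facets that meet \<open>T\<close> correspond to vertices of \<open>T\<close>, hence to the variables \<open>s\<^sub>k\<close>.\<close>
  have "bij_betw v ?T T"
    unfolding bij_betw_def
  proof (intro conjI inj_onI equalityI subsetI)
    fix i j assume ij: "i \<in> ?T" "j \<in> ?T" "v i = v j"
    then have "v i \<in> F i \<inter> F j" using v[OF ij(1)] v[OF ij(2)] by auto
    then show "i = j" using disj[of i j] ij by blast
  next
    fix x assume "x \<in> v ` ?T"
    then show "x \<in> T" using v by blast
  next
    fix x assume x: "x \<in> T"
    then obtain j where j: "j \<in> {1..q}" "x \<in> F j"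
      using facet_cover[OF F] assms(3) by blast
    then have "j \<in> ?T" using x by blast
    moreover have "x = v j" using v[OF \<open>j \<in> ?T\<close>] x j by blast
    ultimately show "x \<in> v ` ?T" by blast
  qed
  then have k: "bij_betw (?rank \<circ> v) ?T ?K"
    using rank by (rule bij_betw_trans)
  define j where "j = inv_into ?T (?rank \<circ> v)"
  have j: "bij_betw j ?K ?T"
    unfolding j_def using k by (rule bij_betw_inv_into)
  have rank_j: "?rank (v (j k)) = k" if "k \<in> ?K" for k
    using bij_betw_inv_into_right[OF k that] by (simp add: j_def)
  have size: "(\<Prod>x\<in>F i. merge_states m T c n x) = b i * n (?rank (v i))" if i: "i \<in> ?T" for i n
  proof -
    have "F i = insert (v i) (F i - T)" "v i \<notin> F i - T" "v i \<in> T"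
      using v[OF i] by auto
    moreover have "finite (F i - T)" using facet_finite[OF F, of i] i by simp
    ultimately have "(\<Prod>x\<in>F i. merge_states m T c n x)
        = merge_states m T c n (v i) * (\<Prod>x\<in>F i - T. merge_states m T c n x)"
      by (metis prod.insert)
    also have "merge_states m T c n (v i) = n (?rank (v i))"
      using \<open>v i \<in> T\<close> by (simp add: merge_states_def)
    also have "(\<Prod>x\<in>F i - T. merge_states m T c n x) = b i"
      unfolding b_def by (rule prod.cong) (auto simp: merge_states_def)
    finally show ?thesis by (simp add: mult.commute)
  qed
  have size': "(\<Prod>x\<in>F i. merge_states m T c n x) = b i" if "i \<in> {1..q} - ?T" for i n
    unfolding b_def using that by (intro prod.cong) (auto simp: merge_states_def)
  have hilbert: "fps_nth (hilbert_series (model_vars m (merge_states m T c n))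
      (toric_ideal m q F (merge_states m T c n) :: (nat \<Rightarrow> nat, 'k) mpoly set)) d
    = of_nat ((\<Prod>k\<in>?K. multichoose (b (j k) * n k) d) * (\<Prod>i\<in>{1..q} - ?T. multichoose (b i) d))"
    for n d
  proof -
    let ?f = "\<lambda>i. multichoose (\<Prod>x\<in>F i. merge_states m T c n x) d"
    have "(\<Prod>i\<in>{1..q}. ?f i) = (\<Prod>i\<in>{1..q} - ?T. ?f i) * (\<Prod>i\<in>?T. ?f i)"
      by (rule prod.subset_diff) auto
    also have "(\<Prod>i\<in>?T. ?f i) = (\<Prod>k\<in>?K. ?f (j k))"
      by (rule prod.reindex_bij_betw[OF j, symmetric])
    also have "\<dots> = (\<Prod>k\<in>?K. multichoose (b (j k) * n k) d)"
      using bij_betwE[OF j] by (intro prod.cong refl) (simp only: size rank_j)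
    also have "(\<Prod>i\<in>{1..q} - ?T. ?f i) = (\<Prod>i\<in>{1..q} - ?T. multichoose (b i) d)"
      by (intro prod.cong refl) (simp only: size')
    finally have prod: "(\<Prod>i\<in>{1..q}. ?f i) = (\<Prod>k\<in>?K. multichoose (b (j k) * n k) d)
        * (\<Prod>i\<in>{1..q} - ?T. multichoose (b i) d)"
      by (simp only: mult.commute)
    show ?thesis
      unfolding prod[symmetric] by (rule hilbert_function_disjoint_facets[OF F]) (rule disj)
  qed
  have K: "{0..card T} = insert 0 ?K" by auto
  have "equiv_hilbert_series TYPE('k) m q F T c = (\<lambda>e.
    if Poly_Mapping.keys e \<subseteq> insert 0 ?K \<and> (\<forall>k\<in>?K. Poly_Mapping.lookup e k \<ge> 1)
    then of_nat ((\<Prod>k\<in>?K. multichoose (b (j k) * Poly_Mapping.lookup e k) (Poly_Mapping.lookup e 0))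
      * (\<Prod>i\<in>{1..q} - ?T. multichoose (b i) (Poly_Mapping.lookup e 0)))
    else 0)"
    unfolding equiv_hilbert_series_def Let_def hilbert K by (rule refl)

  moreover have "rational_mseries (insert 0 ?K) \<dots>"
    by (rule rational_multichoose_product) auto
  ultimately show ?thesis unfolding K by (simp only:)
qed

end
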